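(* Let $n\ge 2$ be an integer and $\alpha>0$ a real number. Consider the equation $$\sum_{i,j=1}^n\Bigl(\delta_{ij}-\frac{u_iu_j}{1+|\nabla u|^2}\Bigr)u_{ij}=\Bigl(\frac{1}{\sqrt{1+|\nabla u|^2}}\Bigr)^{\alpha-1}\quad\text{for all }x\in\mathbb{R}^n. \qquad (E)$$ Then (E) has a unique solution of the form $u(x)=r(|x|)$ up to a translation in $\mathbb{R}^{n+1}$. Moreover, the function $r\in C^2[0,\infty)$ satisfies, for all $t>0$, $$r''(t)>0\qquad\text{and}\qquad \frac{t}{n}<r'(t)\bigl(1+(r'(t))^2\bigr)^{\frac{\alpha-1}{2}}<\frac{t}{n-1},$$ and, as $t\to\infty$: if $\alpha=1$, then $$r(t)=\frac{t^2}{2(n-1)}-\ln t+C_1-\frac{(n-1)(n-4)}{2}t^{-2}+o(t^{-2}),$$ where $C_1$ is a constant depending on $r(1)$; if $\alpha\neq 1$, then $$r(t)=\frac{\alpha}{\alpha+1}\Bigl(\frac{1}{n-1}\Bigr)^{1/\alpha}t^{1+\frac1\alpha}-C(\alpha,n)\,t^{1-\frac1\alpha}+o\bigl(t^{1-\frac1\alpha}\bigr),$$ where $$C(\alpha,n)=\frac{1}{\alpha-1}(n-1)^{1/\alpha}\Bigl(\frac{1}{\alpha(n-1)}+\frac{\alpha-1}{2}\Bigr).$$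
   Context: Subscripts denote partial derivatives: $u_i=\partial u/\partial x_i$, $u_{ij}=\partial^2u/\partial x_i\partial x_j$; $\delta_{ij}$ is the Kronecker delta. "Up to a translation in $\mathbb{R}^{n+1}$" refers to translations of the graph $\{(x,u(x))\}\subset\mathbb{R}^{n+1}$.
   Formalization: For 0<α<1 the expansion is stated for r+c with a suitable constant c (a vertical translation): there t^{1-1/α}→0, so the display cannot hold for both r and r+1, which both solve (E). For α>1 it holds for every radial solution r as displayed. *)

theory Defs
  imports "HOL-Analysis.Analysis" "HOL-Library.Landau_Symbols"
begin

definition partial_deriv :: "'n::finite \<Rightarrow> (real ^ 'n \<Rightarrow> real) \<Rightarrow> real ^ 'n \<Rightarrow> real"
  where "partial_deriv i u x = deriv (\<lambda>h. u (x + h *\<^sub>R axis i 1)) 0"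

definition gradient :: "(real ^ 'n::finite \<Rightarrow> real) \<Rightarrow> real ^ 'n \<Rightarrow> real ^ 'n"
  where "gradient u x = (\<chi> i. partial_deriv i u x)"

text \<open>\<open>deriv\<close> is total, so existence of the partial derivatives is required separately
  from their continuity.\<close>

definition C1_function :: "(real ^ 'n::finite \<Rightarrow> real) \<Rightarrow> bool"
  where "C1_function u \<longleftrightarrow>
    (\<forall>i. (\<forall>x. (\<lambda>h. u (x + h *\<^sub>R axis i 1)) differentiable (at 0)) \<and>
         continuous_on UNIV (partial_deriv i u))"

definition C2_function :: "(real ^ 'n::finite \<Rightarrow> real) \<Rightarrow> bool"
  where "C2_function u \<longleftrightarrow> C1_function u \<and> (\<forall>i. C1_function (partial_deriv i u))"

definition entire_solution :: "real \<Rightarrow> (real ^ 'n::finite \<Rightarrow> real) \<Rightarrow> bool"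
  where "entire_solution \<alpha> u \<longleftrightarrow> C2_function u \<and>
    (\<forall>x. (\<Sum>i\<in>UNIV. \<Sum>j\<in>UNIV.
            ((if i = j then 1 else 0)
               - partial_deriv i u x * partial_deriv j u x / (1 + (norm (gradient u x))\<^sup>2))
            * partial_deriv j (partial_deriv i u) x)
       = (1 / sqrt (1 + (norm (gradient u x))\<^sup>2)) powr (\<alpha> - 1))"

text \<open>Profiles \<open>r\<close> live on \<open>[0,\<infinity>)\<close>; the values of the HOL function at negative
  arguments are irrelevant, and derivatives at \<open>0\<close> are one-sided.\<close>

definition C2_on_halfline :: "(real \<Rightarrow> real) \<Rightarrow> bool"
  where "C2_on_halfline r \<longleftrightarrow> (\<exists>r1 r2.
    (\<forall>t\<ge>0. (r has_real_derivative r1 t) (at t within {0..})) \<and>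
    (\<forall>t\<ge>0. (r1 has_real_derivative r2 t) (at t within {0..})) \<and>
    continuous_on {0..} r2)"

definition radial :: "(real \<Rightarrow> real) \<Rightarrow> real ^ 'n::finite \<Rightarrow> real"
  where "radial r x = r (norm x)"

definition fun_graph :: "(real ^ 'n::finite \<Rightarrow> real) \<Rightarrow> ((real ^ 'n) \<times> real) set"
  where "fun_graph u = range (\<lambda>x. (x, u x))"

definition equal_up_to_translation ::
    "(real ^ 'n::finite \<Rightarrow> real) \<Rightarrow> (real ^ 'n \<Rightarrow> real) \<Rightarrow> bool"
  where "equal_up_to_translation u v \<longleftrightarrow> (\<exists>w. fun_graph v = (\<lambda>p. p + w) ` fun_graph u)"

definition C_coeff :: "real \<Rightarrow> nat \<Rightarrow> real"
  where "C_coeff \<alpha> n = 1 / (\<alpha> - 1) * (real n - 1) powr (1 / \<alpha>)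
           * (1 / (\<alpha> * (real n - 1)) + (\<alpha> - 1) / 2)"

end

theory Submission
  imports Defs
begin

text \<open>
  For \<open>u(x) = r(|x|)\<close> with slope \<open>p = r'\<close> the equation reads
  \<open>p' / (1 + p\<^sup>2) + m p / t = (1 + p\<^sup>2)\<^bsup>(1 - \<alpha>) / 2\<^esup>\<close>, where \<open>m = n - 1\<close>.
  In terms of \<open>s = p / sqrt (1 + p\<^sup>2)\<close> it takes the divergence form
  \<open>(t\<^sup>m s)' = t\<^sup>m (1 - s\<^sup>2)\<^bsup>\<alpha> / 2\<^esup>\<close>. The right-hand side decreases in \<open>s\<close>, which
  gives uniqueness. Cut off away from \<open>s = 1\<close> it is Lipschitz, which gives existence by a fixed
  point argument, and a barrier shows that on bounded intervals the cut-off is not felt.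

  For the asymptotics put \<open>y = p (1 + p\<^sup>2)\<^bsup>(\<alpha> - 1) / 2\<^esup>\<close>. The defect
  \<open>e = t - m y\<close> satisfies the linear equation \<open>e' = 1 - a e\<close> with
  \<open>a = m (1 + \<alpha> p\<^sup>2) / t\<close> and \<open>t a \<longlongrightarrow> \<infinity>\<close>, so that
  \<open>a e \<longlongrightarrow> 1\<close>. Applied repeatedly, this yields one term of the expansion of \<open>p\<close>
  after the other.
\<close>

section \<open>Asymptotics of linear equations and of antiderivatives\<close>

text \<open>Two obstacles shape the existence part: the term \<open>m p / t\<close> is singular at
  \<open>0\<close>, and a blow-up of \<open>p\<close> at finite \<open>t\<close> has to be excluded.
  In \<open>s\<close> the first disappears, because the flux \<open>t^m s\<close> is a plain
  integral, and the second becomes the question whether \<open>s\<close> reaches \<open>1\<close>,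
  where for \<alpha> < 2 the right-hand side has unbounded derivative.

  The quantity \<open>y\<close> is \<open>s\<close> divided by the right-hand side
  \<open>(1 - s^2) powr (\<alpha> / 2)\<close>. Its upper bound is \<open>s' > 0\<close>; its lower
  bound compares the flux with the integral whose integrand is frozen at the endpoint. The
  derivative of \<open>y\<close> contains the factor \<open>1 - m y / t = e / t\<close>, hence the
  linear equation for \<open>e\<close>.

  Radial solutions differ by constants, that is, by vertical translations. For \<alpha> > 1 the
  error bound grows and absorbs any constant; for \<alpha> < 1 it decays, so the expansion holds
  only after a suitable vertical shift, the \<open>c\<close> of the last clause; for \<alpha> = 1
  the free constant is a function of \<open>r 1\<close>.\<close>

lemma filterlim_powr_at_top:
  fixes \<beta> :: real
  assumes "\<beta> > 0"
  shows "filterlim (\<lambda>t. t powr \<beta>) at_top at_top"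
proof -
  have "filterlim (\<lambda>t. exp (\<beta> * ln t)) at_top at_top"
    by (intro filterlim_compose[OF exp_at_top]
        filterlim_tendsto_pos_mult_at_top[OF tendsto_const assms ln_at_top])
  then show ?thesis
    by (rule filterlim_mono_eventually)
      (use eventually_gt_at_top[of 0] in \<open>auto elim!: eventually_mono simp: powr_def\<close>)
qed

text \<open>L'Hopital's rule for \<open>(w E) / E\<close>, where \<open>E\<close> is the integrating factor.\<close>

lemma attracting_linear_ode:
  fixes a l w :: "real \<Rightarrow> real" and c L :: real
  assumes cont: "continuous_on {0<..} a"
    and ta: "filterlim (\<lambda>t. t * a t) at_top at_top"
    and l: "(l \<longlongrightarrow> L) at_top"
    and w: "\<And>t. t > 0 \<Longrightarrow> (w has_real_derivative a t * (l t - w t) + c * w t / t) (at t)"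
  shows "(w \<longlongrightarrow> L) at_top"
proof -
  \<comment> \<open>\<open>A\<close> is the logarithm of the integrating factor: with
    \<open>A' = a - c / t\<close> the equation becomes \<open>(w E)' = a l E\<close>.\<close>
  define A where "A t = integral {1..t} a - c * ln t" for t
  define E where "E t = exp (A t)" for t
  have A': "(A has_real_derivative a t - c / t) (at t)" if "t > 1" for t
  proof -
    have "continuous_on {1..t+1} a"
      by (rule continuous_on_subset[OF cont]) auto
    from integral_has_real_derivative[OF this, of t] that
    have "((\<lambda>u. integral {1..u} a) has_real_derivative a t) (at t within {1..t+1})" by simp
    moreover have "at t within {1..t+1} = at t"
      using that by (intro at_within_interior) auto
    ultimately have "((\<lambda>u. integral {1..u} a) has_real_derivative a t) (at t)" by simp
    then show ?thesis unfolding A_def using that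
      by (auto intro!: derivative_eq_intros)
  qed
  have E': "(E has_real_derivative (a t - c / t) * E t) (at t)" if "t > 1" for t
    unfolding E_def using A'[OF that] by (auto intro!: derivative_eq_intros)
  \<comment> \<open>The threshold \<open>1 + \<bar>c\<bar>\<close> makes
    \<open>A' \<ge> 1 / t\<close>, so \<open>A - ln\<close> is nondecreasing and \<open>E\<close>
    tends to infinity at least as fast as a multiple of \<open>t\<close>.\<close>
  have big: "eventually (\<lambda>t. t * a t \<ge> 1 + \<bar>c\<bar>) at_top"
    using ta by (simp add: filterlim_at_top)
  then obtain T0 where T0: "\<And>t. t \<ge> T0 \<Longrightarrow> t * a t \<ge> 1 + \<bar>c\<bar>"
    by (auto simp: eventually_at_top_linorder)
  define T where "T = max T0 2"
  have T: "t * a t \<ge> 1 + \<bar>c\<bar>" "t > 1" if "t \<ge> T" for t using T0 that by (auto simp: T_def)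
  have ge: "A T - ln T \<le> A t - ln t" if "t \<ge> T" for t
  proof (rule DERIV_nonneg_imp_nondecreasing[OF that])
    fix x assume x: "T \<le> x" "x \<le> t"
    have "((\<lambda>x. A x - ln x) has_real_derivative a x - c / x - 1 / x) (at x)"
      using A'[of x] T(2)[of x] x by (auto intro!: derivative_eq_intros)
    moreover have "(x * a x - c - 1) / x \<ge> 0"
      using T[of x] x by simp
    then have "a x - c / x - 1 / x \<ge> 0"
      using T(2)[of x] x by (simp add: diff_divide_distrib)
    ultimately show "\<exists>y. ((\<lambda>x. A x - ln x) has_real_derivative y) (at x) \<and> 0 \<le> y" by blast
  qed
  have "filterlim (\<lambda>t. A T - ln T + ln t) at_top at_top"
    by (intro filterlim_tendsto_add_at_top[OF tendsto_const] ln_at_top)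
  then have "filterlim A at_top at_top"
    by (rule filterlim_at_top_mono)
      (use ge in \<open>auto simp: eventually_at_top_linorder intro!: exI[of _ T]\<close>, smt (verit))
  then have Einf: "filterlim E at_top at_top"
    unfolding E_def by (rule filterlim_compose[OF exp_at_top])
  have pos: "a t - c / t > 0" if "t \<ge> T" for t
    using T[OF that] by (simp add: field_simps)
  have "((\<lambda>t. (w t * E t) / E t) \<longlongrightarrow> L) at_top"
  proof (rule lhospital_at_top_at_top[where g' = "\<lambda>t. (a t - c / t) * E t" and f' = "\<lambda>t. a t * l t * E t"])
    show "eventually (\<lambda>t. (a t - c / t) * E t \<noteq> 0) at_top"
      using pos unfolding eventually_at_top_linorder by (intro exI[of _ T]) (auto simp: E_def, smt (verit))
    show "eventually (\<lambda>t. ((\<lambda>t. w t * E t) has_real_derivative a t * l t * E t) (at t)) at_top"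
      using eventually_gt_at_top[of 1]
    proof eventually_elim
      case (elim t)
      show ?case using w[of t] E'[OF elim] elim
        by (auto intro!: derivative_eq_intros simp: algebra_simps)
    qed
    show "eventually (\<lambda>t. (E has_real_derivative (a t - c / t) * E t) (at t)) at_top"
      using eventually_gt_at_top[of 1] by eventually_elim (rule E')
    \<comment> \<open>The quotient of the derivatives of \<open>w E\<close> and \<open>E\<close> is
      \<open>l / (1 - c / (t a))\<close>.\<close>
    have "((\<lambda>t. inverse (t * a t)) \<longlongrightarrow> 0) at_top"
      by (rule tendsto_inverse_0_at_top[OF ta])
    then have "((\<lambda>t. l t / (1 - c * inverse (t * a t))) \<longlongrightarrow> L / (1 - c * 0)) at_top"
      by (intro tendsto_intros l) auto
    then have "((\<lambda>t. l t / (1 - c * inverse (t * a t))) \<longlongrightarrow> L) at_top" by simp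
    then show "((\<lambda>t. a t * l t * E t / ((a t - c / t) * E t)) \<longlongrightarrow> L) at_top"
    proof (rule Lim_transform_eventually)
      show "eventually (\<lambda>t. l t / (1 - c * inverse (t * a t)) = a t * l t * E t / ((a t - c / t) * E t)) at_top"
        using eventually_ge_at_top[of T]
      proof eventually_elim
        case (elim t)
        have at: "t > 0" "a t > 0" using T[OF elim]
          by (auto simp: zero_less_mult_iff dest: order.strict_trans1[rotated])
            (smt (verit) mult_nonneg_nonpos)
        then show ?case using pos[OF elim] by (simp add: E_def field_simps)
      qed
    qed
  qed (fact Einf)
  then show ?thesis by (simp add: E_def)
qed

lemma integrate_small_o_growing:
  fixes f f' :: "real \<Rightarrow> real"
  assumes "\<beta> > 0" and f: "\<And>t. t > 0 \<Longrightarrow> (f has_real_derivative f' t) (at t)"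
    and lim: "((\<lambda>t. f' t * t powr (1 - \<beta>)) \<longlongrightarrow> 0) at_top"
  shows "f \<in> o[at_top](\<lambda>t. t powr \<beta>)"
proof -
  have "((\<lambda>t. f t / t powr \<beta>) \<longlongrightarrow> 0) at_top"
  proof (rule lhospital_at_top_at_top[where f' = f' and g' = "\<lambda>t. \<beta> * t powr (\<beta> - 1)"])
    show "filterlim (\<lambda>t. t powr \<beta>) at_top at_top" using \<open>\<beta> > 0\<close> by (rule filterlim_powr_at_top)
    show "eventually (\<lambda>t. \<beta> * t powr (\<beta> - 1) \<noteq> 0) at_top"
      using eventually_gt_at_top[of 0] by eventually_elim (use \<open>\<beta> > 0\<close> in auto)
    show "eventually (\<lambda>t. (f has_real_derivative f' t) (at t)) at_top"
      using eventually_gt_at_top[of 0] by eventually_elim (rule f)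
    show "eventually (\<lambda>t. ((\<lambda>t. t powr \<beta>) has_real_derivative \<beta> * t powr (\<beta> - 1)) (at t)) at_top"
      using eventually_gt_at_top[of 0] by eventually_elim (auto intro!: derivative_eq_intros)
    have "((\<lambda>t. f' t * t powr (1 - \<beta>) / \<beta>) \<longlongrightarrow> 0 / \<beta>) at_top"
      by (intro tendsto_intros lim) (use \<open>\<beta> > 0\<close> in auto)
    then have "((\<lambda>t. f' t * t powr (1 - \<beta>) / \<beta>) \<longlongrightarrow> 0) at_top" by simp
    then show "((\<lambda>t. f' t / (\<beta> * t powr (\<beta> - 1))) \<longlongrightarrow> 0) at_top"
      by (rule Lim_transform_eventually)
        (use eventually_gt_at_top[of 0] in eventually_elim,
          simp add: powr_diff field_simps)
  qed
  then show ?thesis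
    by (intro smalloI_tendsto) (use eventually_gt_at_top[of 0] in \<open>auto elim: eventually_mono\<close>)
qed

text \<open>Increments of \<open>f\<close> are compared with increments of
  \<open>t powr (- \<beta>)\<close>. As these are summable up to infinity, \<open>f\<close> has a
  limit, and the same comparison gives the rate.\<close>

lemma integrate_small_o_decaying:
  fixes f f' :: "real \<Rightarrow> real"
  assumes "\<beta> > 0" and f: "\<And>t. t > 0 \<Longrightarrow> (f has_real_derivative f' t) (at t)"
    and lim: "((\<lambda>t. f' t * t powr (\<beta> + 1)) \<longlongrightarrow> 0) at_top"
  shows "\<exists>L. (\<lambda>t. f t - L) \<in> o[at_top](\<lambda>t. t powr (- \<beta>))"
proof -
  define g where "g t = t powr (- \<beta>)" for t :: real
  have g0: "(g \<longlongrightarrow> 0) at_top"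
    unfolding g_def using \<open>\<beta> > 0\<close> by (intro tendsto_neg_powr filterlim_ident) auto
  \<comment> \<open>Far out \<open>\<bar>f'\<bar> \<le> - \<epsilon> g'\<close>, so
    \<open>f + \<epsilon> g\<close> is nonincreasing and \<open>f - \<epsilon> g\<close> is
    nondecreasing.\<close>
  have ev: "\<exists>T>0. \<forall>x\<ge>T. \<forall>y\<ge>x. \<bar>f y - f x\<bar> \<le> \<epsilon> * (g x - g y)" if "\<epsilon> > 0" for \<epsilon>
  proof -
    from tendstoD[OF lim, of "\<epsilon> * \<beta>"] that \<open>\<beta> > 0\<close>
    have "eventually (\<lambda>t. \<bar>f' t * t powr (\<beta> + 1)\<bar> < \<epsilon> * \<beta>) at_top"
      by (simp add: dist_real_def)
    then obtain T0 where T0: "\<And>t. t \<ge> T0 \<Longrightarrow> \<bar>f' t * t powr (\<beta> + 1)\<bar> < \<epsilon> * \<beta>"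
      by (auto simp: eventually_at_top_linorder)
    define T where "T = max T0 1"
    have bd: "\<bar>f' t\<bar> \<le> \<epsilon> * \<beta> * t powr (- \<beta> - 1)" if "t \<ge> T" for t
    proof -
      have "t > 0" "t \<ge> T0" using that by (auto simp: T_def)
      with T0[of t] show ?thesis
        by (simp add: abs_mult powr_diff powr_add powr_minus field_simps)
    qed
    have "\<bar>f y - f x\<bar> \<le> \<epsilon> * (g x - g y)" if "x \<ge> T" "y \<ge> x" for x y
    proof -
      have der: "(f has_real_derivative f' t) (at t)"
           "(g has_real_derivative - \<beta> * t powr (- \<beta> - 1)) (at t)" if "t \<ge> x" for t
        using f[of t] that \<open>x \<ge> T\<close> unfolding g_def
        by (auto intro!: derivative_eq_intros simp: T_def)
      have "f y + \<epsilon> * g y \<le> f x + \<epsilon> * g x"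
      proof (rule DERIV_nonpos_imp_nonincreasing[OF \<open>y \<ge> x\<close>])
        fix t assume "x \<le> t" "t \<le> y"
        then show "\<exists>d. ((\<lambda>t. f t + \<epsilon> * g t) has_real_derivative d) (at t) \<and> d \<le> 0"
          using der[of t] bd[of t] \<open>x \<ge> T\<close>
          by (intro exI[of _ "f' t + \<epsilon> * (- \<beta> * t powr (- \<beta> - 1))"]) (auto intro!: derivative_eq_intros)
      qed
      moreover have "f x - \<epsilon> * g x \<le> f y - \<epsilon> * g y"
      proof (rule DERIV_nonneg_imp_nondecreasing[OF \<open>y \<ge> x\<close>])
        fix t assume "x \<le> t" "t \<le> y"
        then show "\<exists>d. ((\<lambda>t. f t - \<epsilon> * g t) has_real_derivative d) (at t) \<and> 0 \<le> d"
          using der[of t] bd[of t] \<open>x \<ge> T\<close>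
          by (intro exI[of _ "f' t - \<epsilon> * (- \<beta> * t powr (- \<beta> - 1))"]) (auto intro!: derivative_eq_intros)
      qed
      ultimately show ?thesis by (auto simp: algebra_simps abs_le_iff)
    qed
    then show ?thesis by (intro exI[of _ T]) (auto simp: T_def)
  qed
  \<comment> \<open>The case \<epsilon> = 1 already produces the limit: \<open>f + g\<close> is
    nonincreasing along \<open>T + k\<close> and bounded below by \<open>f T - g T\<close>, while
    \<open>g\<close> tends to \<open>0\<close>.\<close>
  obtain T where T: "T > 0" "\<And>x y. x \<ge> T \<Longrightarrow> y \<ge> x \<Longrightarrow> \<bar>f y - f x\<bar> \<le> g x - g y"
    using ev[of 1] by auto
  have "decseq (\<lambda>k. f (T + real k) + g (T + real k))"
    using T by (intro decseq_SucI) (smt (verit) of_nat_Suc of_nat_0_le_iff)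
  moreover have "f (T + real k) + g (T + real k) \<ge> f T - g T" for k
    using T(2)[of T "T + real k"] \<open>T > 0\<close> by (auto simp: g_def abs_le_iff)
     (smt (verit) powr_ge_zero)
  ultimately obtain L where L: "(\<lambda>k. f (T + real k) + g (T + real k)) \<longlonglongrightarrow> L"
    using decseq_convergent by blast
  have Tk: "filterlim (\<lambda>k. T + real k) at_top sequentially"
    by (intro filterlim_tendsto_add_at_top[OF tendsto_const] filterlim_real_sequentially)
  have gk: "(\<lambda>k. g (T + real k)) \<longlonglongrightarrow> 0" by (rule filterlim_compose[OF g0 Tk])
  from tendsto_diff[OF L gk] have fk: "(\<lambda>k. f (T + real k)) \<longlonglongrightarrow> L" by simp
  have "(\<lambda>t. f t - L) \<in> o[at_top](g)"
  proof (rule landau_o.smallI)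
    fix \<epsilon> :: real assume "\<epsilon> > 0"
    from ev[OF this] obtain S where S: "S > 0" "\<And>x y. x \<ge> S \<Longrightarrow> y \<ge> x \<Longrightarrow> \<bar>f y - f x\<bar> \<le> \<epsilon> * (g x - g y)"
      by auto
    \<comment> \<open>The right endpoint of the increment estimate is sent to infinity along
      \<open>T + k\<close>.\<close>
    have "\<bar>L - f x\<bar> \<le> \<epsilon> * (g x - 0)" if "x \<ge> S" for x
    proof (rule tendsto_le[OF sequentially_bot])
      show "(\<lambda>k. \<epsilon> * (g x - g (T + real k))) \<longlonglongrightarrow> \<epsilon> * (g x - 0)" by (intro tendsto_intros gk)
      show "(\<lambda>k. \<bar>f (T + real k) - f x\<bar>) \<longlonglongrightarrow> \<bar>L - f x\<bar>" by (intro tendsto_intros fk)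
      have "eventually (\<lambda>k. T + real k \<ge> x) sequentially"
        using Tk by (simp add: filterlim_at_top)
      then show "eventually (\<lambda>k. \<bar>f (T + real k) - f x\<bar> \<le> \<epsilon> * (g x - g (T + real k))) sequentially"
        by eventually_elim (use S(2) that in auto)
    qed
    then show "eventually (\<lambda>t. norm (f t - L) \<le> \<epsilon> * norm (g t)) at_top"
      unfolding eventually_at_top_linorder
      by (intro exI[of _ S]) (auto simp: g_def abs_minus_commute)
  qed
  then show ?thesis unfolding g_def by blast
qed

section \<open>The slope of a radial solution\<close>

text \<open>This is the radial equation solved for \<open>p'\<close>. It is imposed for
  \<open>t > 0\<close> only, since \<open>m p / t\<close> makes no sense at \<open>0\<close>; there
  continuity and \<open>p 0 = 0\<close> are prescribed, and the limit of \<open>p'\<close> is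
  recovered in \<open>slope_limit\<close>.\<close>

locale radial_profile =
  fixes \<alpha> :: real and m :: nat and p :: "real \<Rightarrow> real"
  assumes alpha: "\<alpha> > 0" and m: "m \<ge> 1"
    and zero: "p 0 = 0" and cont: "continuous_on {0..} p"
    and ode: "\<And>t. t > 0 \<Longrightarrow> (p has_real_derivative
      (1 + (p t)\<^sup>2) * ((1 + (p t)\<^sup>2) powr ((1 - \<alpha>) / 2) - m * p t / t)) (at t)"
begin

text \<open>Geometrically \<open>s\<close> is the sine of the angle of inclination of the profile.
  \<open>K\<close> is the right-hand side \<open>(1 - s^2) powr (\<alpha> / 2)\<close> written in
  terms of \<open>p\<close>, and \<open>D\<close> is what the divergence form yields for
  \<open>s'\<close>.\<close>

definition s where "s t = p t / sqrt (1 + (p t)\<^sup>2)"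
definition K where "K t = (1 + (p t)\<^sup>2) powr (- \<alpha> / 2)"
definition D where "D t = K t - m * s t / t"

lemma sq_pos [simp]: "0 < 1 + (p t)\<^sup>2" "1 + (p t)\<^sup>2 \<noteq> 0" "\<not> 1 + (p t)\<^sup>2 < 0" "0 \<le> 1 + (p t)\<^sup>2"
proof -
  show "0 < 1 + (p t)\<^sup>2" by (simp add: add_pos_nonneg)
  then show "1 + (p t)\<^sup>2 \<noteq> 0" "\<not> 1 + (p t)\<^sup>2 < 0" "0 \<le> 1 + (p t)\<^sup>2" by auto
qed

lemma K_pos: "K t > 0" unfolding K_def by (simp add: powr_gt_zero)

lemma sqrt_powr: "sqrt (1 + (p t)\<^sup>2) = (1 + (p t)\<^sup>2) powr (1 / 2)"
  by (simp add: powr_half_sqrt less_imp_le)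

lemma powr_K: "(1 + (p t)\<^sup>2) powr ((1 - \<alpha>) / 2) = sqrt (1 + (p t)\<^sup>2) * K t"
  by (simp add: sqrt_powr K_def diff_divide_distrib flip: powr_add)

text \<open>A factor \<open>sqrt (1 + p^2)\<close> comes out of the bracket and leaves
  \<open>D\<close>. Hence \<open>p'\<close> and \<open>s'\<close> have the same sign, so that
  convexity of the profile reduces to \<open>D > 0\<close>.\<close>

lemma ode': "t > 0 \<Longrightarrow> (p has_real_derivative sqrt (1 + (p t)\<^sup>2) ^ 3 * D t) (at t)"
proof -
  assume "t > 0"
  have "m * p t / t = sqrt (1 + (p t)\<^sup>2) * (m * s t / t)"
    by (simp add: s_def)
  moreover have "1 + (p t)\<^sup>2 = sqrt (1 + (p t)\<^sup>2) ^ 2" by (simp add: less_imp_le)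
  ultimately have "(1 + (p t)\<^sup>2) * ((1 + (p t)\<^sup>2) powr ((1 - \<alpha>) / 2) - m * p t / t)
      = sqrt (1 + (p t)\<^sup>2) ^ 2 * (sqrt (1 + (p t)\<^sup>2) * K t - sqrt (1 + (p t)\<^sup>2) * (m * s t / t))"
    by (simp add: powr_K)
  also have "\<dots> = sqrt (1 + (p t)\<^sup>2) ^ 3 * D t"
    unfolding D_def by (simp only: power3_eq_cube power2_eq_square algebra_simps)
  finally show ?thesis using ode[OF \<open>t > 0\<close>] by simp
qed

lemma s_deriv: assumes "t > 0" shows "(s has_real_derivative D t) (at t)"
proof -
  define q where "q = sqrt (1 + (p t)\<^sup>2)"
  have q: "q > 0" "(p t)\<^sup>2 = q\<^sup>2 - 1" by (auto simp: q_def less_imp_le)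
  have "((\<lambda>t. sqrt (1 + (p t)\<^sup>2)) has_real_derivative p t * (q ^ 3 * D t) / q) (at t)"
    by (auto intro!: derivative_eq_intros ode'[OF assms, folded q_def] simp flip: q_def simp: field_simps)
  then have "(s has_real_derivative (q ^ 3 * D t * q - p t * (p t * (q ^ 3 * D t) / q)) / (q * q)) (at t)"
    unfolding s_def using q
    using DERIV_divide[OF ode'[OF assms, folded q_def], of "\<lambda>t. sqrt (1 + (p t)\<^sup>2)"
      "p t * (q ^ 3 * D t) / q"] by (simp flip: q_def)
  also have "(q ^ 3 * D t * q - p t * (p t * (q ^ 3 * D t) / q)) / (q * q)
     = (q\<^sup>2 - (p t)\<^sup>2) * D t"
    using q(1) by (simp add: field_simps power2_eq_square power3_eq_cube)
  finally show ?thesis by (simp add: q)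
qed

lemma s_cont: "continuous_on {0..} s"
  unfolding s_def by (intro continuous_intros cont) (simp add: less_imp_le)

lemma s_zero: "s 0 = 0" by (simp add: s_def zero)

lemma K_cont: "continuous_on {0..} K"
  unfolding K_def by (intro continuous_intros cont) simp

lemma K_s: "K t = (1 - (s t)\<^sup>2) powr (\<alpha> / 2)" and s_lt_1: "\<bar>s t\<bar> < 1"
proof -
  have *: "(s t)\<^sup>2 = (p t)\<^sup>2 / (1 + (p t)\<^sup>2)" by (simp add: s_def power_divide less_imp_le)
  then have "1 - (s t)\<^sup>2 = inverse (1 + (p t)\<^sup>2)" by (simp add: field_simps)
  then show "K t = (1 - (s t)\<^sup>2) powr (\<alpha> / 2)"
    by (simp add: K_def powr_minus inverse_powr less_imp_le)
  have "(s t)\<^sup>2 < 1\<^sup>2" using * by simp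
  then show "\<bar>s t\<bar> < 1" by (simp add: abs_square_less_1)
qed

lemma p_s: "p t = s t / sqrt (1 - (s t)\<^sup>2)"
proof -
  have "(s t)\<^sup>2 = (p t)\<^sup>2 / (1 + (p t)\<^sup>2)" by (simp add: s_def power_divide less_imp_le)
  then have "1 - (s t)\<^sup>2 = inverse (1 + (p t)\<^sup>2)" by (simp add: field_simps)
  then show ?thesis by (simp add: real_sqrt_inverse s_def)
qed

lemma flux_deriv: "t > 0 \<Longrightarrow> ((\<lambda>t. t ^ m * s t) has_real_derivative t ^ m * K t) (at t)"
proof -
  assume t: "t > 0"
  have "t ^ m = t ^ (m - 1) * t" using m by (simp flip: power_Suc2)
  then show ?thesis using t
    by (auto intro!: derivative_eq_intros s_deriv simp: D_def field_simps)
qed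

lemma flux_cont: "continuous_on {0..} (\<lambda>t. t ^ m * s t)"
  by (intro continuous_intros s_cont)

text \<open>The flux \<open>t^m s\<close> starts at \<open>0\<close> and has the positive derivative
  \<open>t^m K\<close>.\<close>

lemma s_pos: assumes "t > 0" shows "s t > 0"
proof -
  have "0 ^ m * s 0 < t ^ m * s t"
  proof (rule DERIV_pos_imp_increasing_open[OF assms])
    show "\<exists>y. ((\<lambda>t. t ^ m * s t) has_real_derivative y) (at x) \<and> 0 < y" if "0 < x" for x
      using flux_deriv[OF that] K_pos[of x] that by (intro exI[of _ "x ^ m * K x"]) auto
    show "continuous_on {0..t} (\<lambda>t. t ^ m * s t)"
      by (rule continuous_on_subset[OF flux_cont]) auto
  qed
  then show ?thesis using assms by (simp add: s_zero zero_less_mult_iff)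
qed

lemma p_pos: "t > 0 \<Longrightarrow> p t > 0"
  using s_pos[of t] by (simp add: s_def zero_less_divide_iff)

section \<open>Behaviour of the profile at the origin\<close>

lemma at_right_0: "(s \<longlongrightarrow> 0) (at_right 0)" "(p \<longlongrightarrow> 0) (at_right 0)" "(K \<longlongrightarrow> 1) (at_right 0)"
proof -
  have *: "(f \<longlongrightarrow> f 0) (at_right 0)" if "continuous_on {0..} f" for f :: "real \<Rightarrow> real"
  proof -
    have "(f \<longlongrightarrow> f 0) (at 0 within {0..})" using that by (auto simp: continuous_on)
    then show ?thesis by (rule tendsto_within_subset) auto
  qed
  show "(s \<longlongrightarrow> 0) (at_right 0)" using *[OF s_cont] by (simp add: s_zero)
  show "(p \<longlongrightarrow> 0) (at_right 0)" using *[OF cont] by (simp add: zero)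
  show "(K \<longlongrightarrow> 1) (at_right 0)" using *[OF K_cont] by (simp add: K_def zero)
qed

text \<open>So far \<open>s\<close> is only known to be continuous at \<open>0\<close>. L'Hopital's
  rule for the flux over \<open>t^(m+1)\<close> needs only \<open>K \<longlongrightarrow> 1\<close>
  and gives the slope of \<open>s\<close> there.\<close>

lemma s_over_t_limit: "((\<lambda>t. s t / t) \<longlongrightarrow> 1 / (real m + 1)) (at_right 0)"
proof -
  have "((\<lambda>t. (t ^ m * s t) / t ^ (m + 1)) \<longlongrightarrow> 1 / (real m + 1)) (at_right 0)"
  proof (rule lhopital_right_0[where f' = "\<lambda>t. t ^ m * K t" and g' = "\<lambda>t. (m + 1) * t ^ m"])
    show "((\<lambda>t. t ^ m * s t) \<longlongrightarrow> 0) (at_right 0)"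
    proof -
      have "((\<lambda>t. t ^ m * s t) \<longlongrightarrow> 0 ^ m * 0) (at_right 0)"
        by (intro tendsto_intros at_right_0)
      then show ?thesis by simp
    qed
    show "((\<lambda>t::real. t ^ (m + 1)) \<longlongrightarrow> 0) (at_right 0)"
      by (intro tendsto_eq_intros) auto
    show "eventually (\<lambda>t::real. t ^ (m + 1) \<noteq> 0) (at_right 0)"
      using eventually_at_right_less[of "0::real"] by eventually_elim auto
    show "eventually (\<lambda>t::real. real (m + 1) * t ^ m \<noteq> 0) (at_right 0)"
      using eventually_at_right_less[of "0::real"] by eventually_elim auto
    show "eventually (\<lambda>t. ((\<lambda>t. t ^ m * s t) has_real_derivative t ^ m * K t) (at t)) (at_right 0)"
      using eventually_at_right_less by eventually_elim (rule flux_deriv)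
    show "eventually (\<lambda>t::real. ((\<lambda>t. t ^ (m + 1)) has_real_derivative real (m + 1) * t ^ m) (at t)) (at_right 0)"
      using DERIV_pow[of "m + 1"] by (intro always_eventually allI) (simp del: of_nat_add of_nat_Suc)
    have "((\<lambda>t. K t / (real m + 1)) \<longlongrightarrow> 1 / (real m + 1)) (at_right 0)"
      by (intro tendsto_intros at_right_0) auto
    then have "((\<lambda>t. K t / real (m + 1)) \<longlongrightarrow> 1 / (real m + 1)) (at_right 0)"
      by (simp add: add.commute)
    then show "((\<lambda>t. t ^ m * K t / (real (m + 1) * t ^ m)) \<longlongrightarrow> 1 / (real m + 1)) (at_right 0)"
      by (rule Lim_transform_eventually) (auto simp: eventually_at_filter)
  qed
  then show ?thesis
    by (rule Lim_transform_eventually) (auto simp: eventually_at_filter)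
qed

lemma m_pos [simp]: "real m > 0" "m > 0" using m by auto

lemma D_limit: "(D \<longlongrightarrow> 1 / (real m + 1)) (at_right 0)"
proof -
  have "((\<lambda>t. K t - m * (s t / t)) \<longlongrightarrow> 1 - m * (1 / (real m + 1))) (at_right 0)"
    by (intro tendsto_intros at_right_0 s_over_t_limit)
  moreover have "1 - m * (1 / (real m + 1)) = 1 / (real m + 1)" by (simp add: field_simps)
  ultimately show ?thesis unfolding D_def by simp
qed

lemma p_over_t_limit: "((\<lambda>t. p t / t) \<longlongrightarrow> 1 / (real m + 1)) (at_right 0)"
proof -
  have "((\<lambda>t. (s t / t) * sqrt (1 + (p t)\<^sup>2)) \<longlongrightarrow> 1 / (real m + 1) * sqrt (1 + 0\<^sup>2)) (at_right 0)"
    by (intro tendsto_intros at_right_0 s_over_t_limit)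
  then show ?thesis by (simp add: s_def)
qed

text \<open>\<open>p'\<close> and \<open>p / t\<close> have the same limit at \<open>0\<close>. This
  is what makes the Hessian of \<open>r(|x|)\<close> continuous at the origin.\<close>

lemma slope_limit:
  "((\<lambda>t. (1 + (p t)\<^sup>2) * ((1 + (p t)\<^sup>2) powr ((1 - \<alpha>) / 2) - m * p t / t)) \<longlongrightarrow> 1 / (real m + 1)) (at_right 0)"
proof -
  have "((\<lambda>t. (1 + (p t)\<^sup>2) * ((1 + (p t)\<^sup>2) powr ((1 - \<alpha>) / 2) - m * (p t / t))) \<longlongrightarrow>
    (1 + 0\<^sup>2) * ((1 + 0\<^sup>2) powr ((1 - \<alpha>) / 2) - m * (1 / (real m + 1)))) (at_right 0)"
    by (intro tendsto_intros at_right_0 p_over_t_limit) auto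
  moreover have "1 - m * (1 / (real m + 1)) = 1 / (real m + 1)" by (simp add: field_simps)
  ultimately show ?thesis by simp
qed

lemma D_cont: "continuous_on {0<..} D"
  unfolding D_def
  by (intro continuous_intros continuous_on_subset[OF s_cont] continuous_on_subset[OF K_cont]) auto

text \<open>At a first zero of \<open>D = s'\<close> the derivative of \<open>D\<close> would be \<open>m s / t\<^sup>2 > 0\<close>.\<close>

lemma D_pos: assumes "t > 0" shows "D t > 0"
proof (rule ccontr)
  assume neg: "\<not> D t > 0"
  have "eventually (\<lambda>x. D x > 0) (at_right 0)"
    by (rule order_tendstoD[OF D_limit]) auto
  then obtain d where d: "d > 0" "\<And>x. 0 < x \<Longrightarrow> x < d \<Longrightarrow> D x > 0"
    by (auto simp: eventually_at_right_field)
  define c where "c = d / 2"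
  have c: "c > 0" "c < t" "D c > 0" using d neg assms d(2)[of c] d(2)[of t] by (auto simp: c_def not_less)
    (smt (verit) d(2) field_sum_of_halves)
  \<comment> \<open>\<open>Inf Z\<close> will be the first point after \<open>c\<close> at which
    \<open>D\<close> fails to be positive; \<open>c\<close> is taken so near to \<open>0\<close>
    that \<open>D_limit\<close> makes \<open>D\<close> positive there.\<close>
  define Z where "Z = {x \<in> {c..t}. D x \<le> 0}"
  have "continuous_on {c..t} D" by (rule continuous_on_subset[OF D_cont]) (use c in auto)
  then have "closed Z" unfolding Z_def
    using continuous_on_closed_Collect_le[of "{c..t}" D "\<lambda>_. 0"] by simp
  moreover have "t \<in> Z" "bdd_below Z" using neg c by (auto simp: Z_def intro!: bdd_belowI[of _ c])
  ultimately have Zin: "Inf Z \<in> Z" by (intro closed_contains_Inf) auto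
  define z where "z = Inf Z"
  have z: "c \<le> z" "D z \<le> 0" using Zin by (auto simp: Z_def z_def)
  have before: "D x > 0" if "c \<le> x" "x < z" for x
    using cInf_lower[OF _ \<open>bdd_below Z\<close>, of x] that Zin unfolding z_def Z_def
    by (auto simp: not_less) (smt (verit))
  have "c < z" using z c by (cases "c = z") auto
  have "D z = 0"
  proof (rule antisym[OF z(2)])
    have "continuous_on {c..z} D" by (rule continuous_on_subset[OF D_cont]) (use c in auto)
    then have "(D \<longlongrightarrow> D z) (at z within {c..z})"
      using \<open>c < z\<close> by (simp add: continuous_on)
    then have "(D \<longlongrightarrow> D z) (at_left z)"
      using \<open>c < z\<close> by (simp add: at_within_Icc_at_left)
    moreover have "eventually (\<lambda>x. D x \<ge> 0) (at_left z)"
      using eventually_at_left_real[OF \<open>c < z\<close>] 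
      by eventually_elim (use before in \<open>auto intro: less_imp_le\<close>)
    ultimately show "0 \<le> D z" by (rule tendsto_lowerbound) auto
  qed
  have "z > 0" using z c by simp
  \<comment> \<open>Both \<open>p'\<close> and \<open>s'\<close> are multiples of \<open>D\<close>
    and vanish at \<open>z\<close>, so in \<open>D = K - m s / t\<close> only the explicit
    \<open>1 / t\<close> contributes to the derivative.\<close>
  have "(p has_real_derivative 0) (at z)" using ode'[OF \<open>z > 0\<close>] \<open>D z = 0\<close> by simp
  then have "(K has_real_derivative 0) (at z)"
    unfolding K_def by (auto intro!: derivative_eq_intros)
  moreover have "(s has_real_derivative 0) (at z)" using s_deriv[OF \<open>z > 0\<close>] \<open>D z = 0\<close> by simp
  ultimately have "(D has_real_derivative m * s z / z\<^sup>2) (at z)"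
    unfolding D_def using \<open>z > 0\<close>
    by (auto intro!: derivative_eq_intros simp: field_simps power2_eq_square)
  moreover have "m * s z / z\<^sup>2 > 0" using s_pos[OF \<open>z > 0\<close>] m \<open>z > 0\<close> by simp
  ultimately have "\<exists>e>0. \<forall>h>0. h < e \<longrightarrow> D (z - h) < D z" by (rule DERIV_pos_inc_left)
  then obtain e where e: "e > 0" "\<And>h. 0 < h \<Longrightarrow> h < e \<Longrightarrow> D (z - h) < D z" by blast
  define h where "h = min (e / 2) (z - c)"
  have "0 < h" "h < e" "c \<le> z - h" "z - h < z" using e(1) \<open>c < z\<close> by (auto simp: h_def)
  with e(2)[of h] before[of "z - h"] \<open>D z = 0\<close> show False by simp
qed

section \<open>The two-sided bound on \<open>y\<close>\<close>

definition y where "y t = p t * (1 + (p t)\<^sup>2) powr ((\<alpha> - 1) / 2)"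

lemma y_s: "y t = s t / K t"
proof -
  have "(1 + (p t)\<^sup>2) powr ((\<alpha> - 1) / 2) = 1 / (sqrt (1 + (p t)\<^sup>2) * K t)"
    using powr_minus_divide[of "1 + (p t)\<^sup>2" "(1 - \<alpha>) / 2"]
    by (simp add: minus_divide_left powr_K)
  then show ?thesis by (simp add: y_def s_def)
qed

text \<open>This is \<open>D > 0\<close>, that is \<open>m s / t < K\<close>, divided by
  \<open>K\<close>.\<close>

lemma y_upper: "t > 0 \<Longrightarrow> y t < t / m"
  using D_pos[of t] K_pos[of t] m by (simp add: y_s D_def field_simps)

lemma s_increasing: "0 < a \<Longrightarrow> a < b \<Longrightarrow> s a < s b"
  by (rule DERIV_pos_imp_increasing[of a b s]) (auto intro!: exI[of _ "D _"] s_deriv D_pos)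

text \<open>As \<open>s\<close> increases, \<open>K\<close> decreases, so on \<open>(0, t)\<close>
  the derivative \<open>x^m K x\<close> of the flux exceeds \<open>x^m K t\<close>. Integration from
  \<open>0\<close> to \<open>t\<close> gives \<open>s t > K t * t / (m + 1)\<close>.\<close>

lemma y_lower: assumes t: "t > 0" shows "t / (m + 1) < y t"
proof -
  have "t ^ m * s t - K t * t ^ (m + 1) / (m + 1) > 0 ^ m * s 0 - K t * 0 ^ (m + 1) / (m + 1)"
  proof (rule DERIV_pos_imp_increasing_open[OF t, where f = "\<lambda>x. x ^ m * s x - K t * x ^ (m + 1) / (m + 1)"])
    fix x assume x: "0 < x" "x < t"
    have "(s x)\<^sup>2 < (s t)\<^sup>2" using s_increasing[OF x] s_pos[OF x(1)] by (intro power_strict_mono) auto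
    moreover have "(s t)\<^sup>2 < 1" using s_lt_1[of t] by (simp add: abs_square_less_1)
    ultimately have "K t < K x" unfolding K_s using alpha by (intro powr_less_mono2) auto
    moreover have "((\<lambda>x. x ^ m * s x - K t * x ^ (m + 1) / (m + 1)) has_real_derivative
        x ^ m * K x - K t * ((m + 1) * x ^ m) / (m + 1)) (at x)"
      using DERIV_diff[OF flux_deriv[OF x(1)] DERIV_cdivide[OF DERIV_cmult[OF DERIV_pow[of "m + 1"]]], of "K t" "m + 1"]
      by (simp del: of_nat_add of_nat_Suc)
    moreover have "K t * ((m + 1) * x ^ m) / (m + 1) = x ^ m * K t"
      by (simp del: of_nat_add of_nat_Suc)
    ultimately show "\<exists>y. ((\<lambda>x. x ^ m * s x - K t * x ^ (m + 1) / (m + 1)) has_real_derivative y) (at x) \<and> 0 < y"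
      using x by (intro exI[of _ "x ^ m * K x - x ^ m * K t"]) (auto simp: mult.commute)
  next
    show "continuous_on {0..t} (\<lambda>x. x ^ m * s x - K t * x ^ (m + 1) / (m + 1))"
      by (intro continuous_intros continuous_on_subset[OF s_cont]) auto
  qed
  then have "t ^ m * s t > t ^ m * (K t * t / (m + 1))" by (simp add: s_zero mult_ac)
  then have "s t > K t * t / (m + 1)"
    by (rule mult_left_less_imp_less) (use t in simp)
  then show ?thesis using K_pos[of t] by (simp add: y_s field_simps)
qed

end

text \<open>Since \<open>F s = (1 - s\<^sup>2)\<^sup>\<alpha>\<^sup>/\<^sup>2\<close> is decreasing, \<open>(t\<^sup>m (s\<^sub>1 - s\<^sub>2))\<^sup>2\<close> is nonincreasing.\<close>

lemma flux_equation_unique: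
  fixes s1 s2 :: "real \<Rightarrow> real" and m :: nat
  assumes "\<alpha> > 0" "m \<ge> 1"
    and c: "continuous_on {0..<T} s1" "continuous_on {0..<T} s2"
    and r: "\<And>t. 0 \<le> t \<Longrightarrow> t < T \<Longrightarrow> 0 \<le> s1 t \<and> s1 t \<le> 1" "\<And>t. 0 \<le> t \<Longrightarrow> t < T \<Longrightarrow> 0 \<le> s2 t \<and> s2 t \<le> 1"
    and d: "\<And>t. 0 < t \<Longrightarrow> t < T \<Longrightarrow>
        ((\<lambda>t. t ^ m * s1 t) has_real_derivative t ^ m * (1 - (s1 t)\<^sup>2) powr (\<alpha> / 2)) (at t)"
      "\<And>t. 0 < t \<Longrightarrow> t < T \<Longrightarrow>
        ((\<lambda>t. t ^ m * s2 t) has_real_derivative t ^ m * (1 - (s2 t)\<^sup>2) powr (\<alpha> / 2)) (at t)"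
    and t: "0 < t" "t < T"
  shows "s1 t = s2 t"
proof -
  define f where "f t = (t ^ m * s1 t - t ^ m * s2 t)\<^sup>2" for t
  have "f t \<le> f 0"
  proof (rule DERIV_nonpos_imp_decreasing_open[of 0 t f])
    fix x assume x: "0 < x" "x < t"
    define F where "F u = (1 - u\<^sup>2) powr (\<alpha> / 2)" for u :: real
    have Fmono: "F v \<le> F u" if "0 \<le> u" "u \<le> v" "v \<le> 1" for u v
    proof -
      have "u\<^sup>2 \<le> v\<^sup>2" "v\<^sup>2 \<le> 1" using that by (auto intro: power_mono power_le_one)
      then show ?thesis unfolding F_def using \<open>\<alpha> > 0\<close> by (intro powr_mono2) auto
    qed
    have "(f has_real_derivative 2 * (x ^ m * s1 x - x ^ m * s2 x) * (x ^ m * F (s1 x) - x ^ m * F (s2 x))) (at x)"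
      unfolding f_def F_def using DERIV_power[OF DERIV_diff[OF d(1)[of x] d(2)[of x]], of 2] x t
      by (simp only: mult.assoc) (simp add: mult.commute)
    moreover have "(s1 x - s2 x) * (F (s1 x) - F (s2 x)) \<le> 0"
      using Fmono[of "s1 x" "s2 x"] Fmono[of "s2 x" "s1 x"] r[of x] x t
      by (cases "s1 x \<le> s2 x") (auto simp: mult_le_0_iff)
    then have "(x ^ m)\<^sup>2 * ((s1 x - s2 x) * (F (s1 x) - F (s2 x))) \<le> 0" by (simp add: mult_nonneg_nonpos)
    then have "2 * (x ^ m * s1 x - x ^ m * s2 x) * (x ^ m * F (s1 x) - x ^ m * F (s2 x)) \<le> 0"
      by (simp add: algebra_simps power2_eq_square)
    ultimately show "\<exists>y. (f has_real_derivative y) (at x) \<and> y \<le> 0" by blast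
  next
    show "continuous_on {0..t} f" unfolding f_def
      by (intro continuous_intros continuous_on_subset[OF c(1)] continuous_on_subset[OF c(2)]) (use t in auto)
  qed (use t in auto)
  \<comment> \<open>Both fluxes vanish at \<open>0\<close> because \<open>m \<ge> 1\<close>.\<close>
  moreover have "f 0 = 0" using \<open>m \<ge> 1\<close> by (simp add: f_def)
  ultimately have "f t = 0" unfolding f_def by (smt (verit) zero_le_power2)
  then show ?thesis using t by (simp add: f_def)
qed

lemma profile_unique:
  assumes "radial_profile \<alpha> m p" "radial_profile \<alpha> m q" "t \<ge> 0"
  shows "p t = q t"
proof (cases "t = 0")
  case True
  then show ?thesis using assms(1,2) by (simp add: radial_profile.zero)
next
  case False
  interpret P: radial_profile \<alpha> m p by fact
  interpret Q: radial_profile \<alpha> m q by fact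
  have nn: "0 \<le> P.s x \<and> P.s x \<le> 1" "0 \<le> Q.s x \<and> Q.s x \<le> 1" if "x \<ge> 0" for x
    using that P.s_zero Q.s_zero P.s_pos[of x] Q.s_pos[of x] P.s_lt_1[of x] Q.s_lt_1[of x]
    by (cases "x = 0"; simp add: abs_less_iff less_imp_le)+
  have "P.s t = Q.s t"
    by (rule flux_equation_unique[of \<alpha> m "t + 1"])
      (use False \<open>t \<ge> 0\<close> nn P.alpha P.m P.flux_deriv Q.flux_deriv in
        \<open>auto intro: continuous_on_subset[OF P.s_cont] continuous_on_subset[OF Q.s_cont] simp flip: P.K_s Q.K_s\<close>)
  then show ?thesis by (simp add: P.p_s Q.p_s)
qed

section \<open>Asymptotics of the slope\<close>

text \<open>First-order Taylor expansion of \<open>(1 + x) powr c\<close> at \<open>x = 0\<close>,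
  scaled by \<open>h\<close>. The difference quotient \<open>g\<close> of Caratheodory's criterion
  is continuous at \<open>0\<close> with value \<open>c\<close>, so no remainder term has to be
  estimated.\<close>

lemma powr_first_order:
  fixes x h :: "real \<Rightarrow> real"
  assumes "(x \<longlongrightarrow> 0) F" "((\<lambda>t. x t * h t) \<longlongrightarrow> X) F"
  shows "((\<lambda>t. ((1 + x t) powr c - 1) * h t) \<longlongrightarrow> c * X) F"
proof -
  have "((\<lambda>x. (1 + x) powr c) has_real_derivative c) (at 0)"
    by (auto intro!: derivative_eq_intros)
  then obtain g where g: "\<And>z. (1 + z) powr c - 1 = g z * z" "isCont g 0" "g 0 = c"
    by (auto simp: CARAT_DERIV)
  have "((\<lambda>t. g (x t)) \<longlongrightarrow> c) F"
    using isCont_tendsto_compose[OF g(2) assms(1)] g(3) by simp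
  from tendsto_mult[OF this assms(2)] show ?thesis by (simp add: g(1) mult_ac)
qed

context radial_profile
begin

definition e where "e t = t - m * y t"
definition a where "a t = m * (1 + \<alpha> * (p t)\<^sup>2) / t"
text \<open>The expected leading coefficient of \<open>p\<close>: for large \<open>p\<close> the
  quantity \<open>y\<close> behaves like \<open>p powr \<alpha>\<close>, and \<open>y\<close>
  behaves like \<open>t / m\<close>.\<close>

definition A where "A = (1 / m) powr (1 / \<alpha>)"

lemma A_pos: "A > 0" using m by (simp add: A_def)

text \<open>In the derivative of \<open>s / K\<close> both terms carry the factor
  \<open>D / K\<close>, because \<open>K'\<close> is proportional to \<open>p'\<close> and hence to
  \<open>D\<close>. Since \<open>D / K = 1 - m y / t = e / t\<close>, the equation for
  \<open>e\<close> comes out linear.\<close>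

lemma y_deriv:
  assumes "t > 0"
  shows "(y has_real_derivative (1 + \<alpha> * (p t)\<^sup>2) * (1 - m * y t / t)) (at t)"
proof -
  define q where "q = sqrt (1 + (p t)\<^sup>2)"
  have q: "q > 0" "1 + (p t)\<^sup>2 = q\<^sup>2" by (auto simp: q_def)
  have "((\<lambda>t. 1 + (p t)\<^sup>2) has_real_derivative 2 * p t * (q ^ 3 * D t)) (at t)"
    using DERIV_add[OF DERIV_const[of 1] DERIV_power[OF ode'[OF assms, folded q_def], of 2]]
    by (simp add: mult_ac)
  then have "(K has_real_derivative (- \<alpha> / 2) * (1 + (p t)\<^sup>2) powr (- \<alpha> / 2 - 1) * (2 * p t * (q ^ 3 * D t))) (at t)"
    unfolding K_def by (rule DERIV_fun_powr[of _ _ _ "- \<alpha> / 2", simplified of_nat_1]) simp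
  also have "(1 + (p t)\<^sup>2) powr (- \<alpha> / 2 - 1) = K t / q\<^sup>2"
    by (simp add: powr_diff K_def q)
  also have "(- \<alpha> / 2) * (K t / q\<^sup>2) * (2 * p t * (q ^ 3 * D t)) = - (\<alpha> * K t * p t * q * D t)"
    using q(1) by (simp add: power2_eq_square power3_eq_cube)
  finally have K': "(K has_real_derivative - (\<alpha> * K t * p t * q * D t)) (at t)" .
  have "((\<lambda>t. s t / K t) has_real_derivative
      (D t * K t - s t * (- (\<alpha> * K t * p t * q * D t))) / (K t * K t)) (at t)"
    using K_pos[of t] by (intro DERIV_divide s_deriv[OF assms] K') simp
  also have "(\<lambda>t. s t / K t) = y" by (simp add: fun_eq_iff y_s)
  also have "(D t * K t - s t * (- (\<alpha> * K t * p t * q * D t))) / (K t * K t)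
      = (1 + \<alpha> * p t * (s t * q)) * (D t / K t)"
    using K_pos[of t] by (simp add: field_simps)
  also have "s t * q = p t" using q(1) by (simp add: s_def q_def)
  also have "D t / K t = 1 - m * y t / t"
    using K_pos[of t] assms by (simp add: D_def y_s field_simps)
  finally show ?thesis by (simp add: power2_eq_square mult_ac)
qed

lemma e_deriv: "t > 0 \<Longrightarrow> (e has_real_derivative 1 - a t * e t) (at t)"
  unfolding e_def by (auto intro!: derivative_eq_intros y_deriv simp: a_def field_simps)

lemma a_cont: "continuous_on {0<..} a"
  unfolding a_def by (intro continuous_intros continuous_on_subset[OF cont]) auto

lemma a_pos: "t > 0 \<Longrightarrow> a t > 0"
  unfolding a_def using m alpha by (intro divide_pos_pos mult_pos_pos add_pos_nonneg) auto

text \<open>\<open>y_lower\<close> together with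
  \<open>y \<le> (1 + p^2) powr (\<alpha> / 2)\<close> bounds \<open>1 + p^2\<close> from below by a
  positive power of \<open>t\<close>.\<close>

lemma p_squared_at_top: "filterlim (\<lambda>t. (p t)\<^sup>2) at_top at_top"
proof -
  have *: "(t / (m + 1)) powr (2 / \<alpha>) \<le> 1 + (p t)\<^sup>2" if t: "t > 0" for t
  proof -
    have "y t \<le> sqrt (1 + (p t)\<^sup>2) * (1 + (p t)\<^sup>2) powr ((\<alpha> - 1) / 2)"
      unfolding y_def by (intro mult_right_mono real_le_rsqrt) auto
    also have "\<dots> = (1 + (p t)\<^sup>2) powr (\<alpha> / 2)"
      by (simp add: sqrt_powr diff_divide_distrib flip: powr_add)
    finally have "t / (m + 1) \<le> (1 + (p t)\<^sup>2) powr (\<alpha> / 2)" using y_lower[OF t] by simp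
    then have "(t / (m + 1)) powr (2 / \<alpha>) \<le> ((1 + (p t)\<^sup>2) powr (\<alpha> / 2)) powr (2 / \<alpha>)"
      using alpha t by (intro powr_mono2) auto
    also have "\<dots> = 1 + (p t)\<^sup>2" using alpha by (simp add: powr_powr)
    finally show ?thesis .
  qed
  have **: "eventually (\<lambda>t. -1 + (t / (m + 1)) powr (2 / \<alpha>) \<le> (p t)\<^sup>2) at_top"
    by (rule eventually_mono[OF eventually_gt_at_top[of 0]]) (drule *, linarith)
  have "filterlim (\<lambda>t. t * (1 / (real m + 1))) at_top at_top"
    by (rule filterlim_at_top_mult_tendsto_pos[OF tendsto_const _ filterlim_ident]) simp
  then have "filterlim (\<lambda>t. t / (m + 1)) at_top at_top" by (simp add: add.commute)
  then have "filterlim (\<lambda>t. -1 + (t / (m + 1)) powr (2 / \<alpha>)) at_top at_top"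
    using alpha
    by (intro filterlim_tendsto_add_at_top[OF tendsto_const]
         filterlim_compose[OF filterlim_powr_at_top[of "2 / \<alpha>"]]) auto
  from filterlim_at_top_mono[OF this **] show ?thesis .
qed

lemma ta_at_top: "filterlim (\<lambda>t. t * a t) at_top at_top"
proof -
  have "filterlim (\<lambda>t. m * (1 + \<alpha> * (p t)\<^sup>2)) at_top at_top"
    using alpha m
    by (intro filterlim_tendsto_pos_mult_at_top[OF tendsto_const]
        filterlim_tendsto_add_at_top[OF tendsto_const] p_squared_at_top) auto
  then show ?thesis
    by (rule filterlim_mono_eventually[OF _ order_refl order_refl])
      (use eventually_gt_at_top[of 0] in eventually_elim, simp add: a_def)
qed

text \<open>The first, rough estimate: \<open>m y\<close> is asymptotic to \<open>t\<close>.
  Differentiating the weight \<open>1 / t\<close> produces \<open>c = -1\<close>, and the target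
  \<open>1 / (t a)\<close> tends to \<open>0\<close>.\<close>

lemma e_over_t: "((\<lambda>t. e t / t) \<longlongrightarrow> 0) at_top"
proof (rule attracting_linear_ode[OF a_cont ta_at_top, where l = "\<lambda>t. inverse (t * a t)" and c = "-1"])
  show "((\<lambda>t. inverse (t * a t)) \<longlongrightarrow> 0) at_top" by (rule tendsto_inverse_0_at_top[OF ta_at_top])
  show "((\<lambda>t. e t / t) has_real_derivative
     a t * (inverse (t * a t) - e t / t) + - 1 * (e t / t) / t) (at t)" if "t > 0" for t
  proof -
    have "((\<lambda>t. e t / t) has_real_derivative ((1 - a t * e t) * t - e t * 1) / (t * t)) (at t)"
      using that by (intro DERIV_divide e_deriv DERIV_ident) auto
    also have "((1 - a t * e t) * t - e t * 1) / (t * t) =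
       a t * (inverse (t * a t) - e t / t) + - 1 * (e t / t) / t"
      using that a_pos[OF that] by (simp add: field_simps)
    finally show ?thesis .
  qed
qed

lemma p_inverse_square: "((\<lambda>t. 1 / (p t)\<^sup>2) \<longlongrightarrow> 0) at_top"
  using tendsto_inverse_0_at_top[OF p_squared_at_top] by (simp add: divide_inverse)

text \<open>The definition of \<open>y\<close> reads \<open>y = p powr \<alpha> * (1 + 1 / p^2) powr
  ((\<alpha> - 1) / 2)\<close>. It is solved for \<open>p\<close> with
  \<open>y = (t / m) (1 - e / t)\<close>, which splits \<open>p\<close> into its leading term and
  two correction factors tending to \<open>1\<close>.\<close>

lemma p_factored:
  assumes "t > 0"
  shows "p t = A * t powr (1 / \<alpha>) * ((1 + - (e t / t)) powr (1 / \<alpha>) * (1 + 1 / (p t)\<^sup>2) powr ((1 - \<alpha>) / (2 * \<alpha>)))"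
proof -
  define z where "z = 1 / (p t)\<^sup>2"
  note pp = p_pos[OF assms]
  have z: "z > 0" "1 + (p t)\<^sup>2 = (p t)\<^sup>2 * (1 + z)" using pp by (auto simp: z_def field_simps)
  have "y t = p t * (((p t)\<^sup>2) powr ((\<alpha> - 1) / 2) * (1 + z) powr ((\<alpha> - 1) / 2))"
    unfolding y_def z(2) using z(1) by (simp add: powr_mult)
  also have "((p t)\<^sup>2) powr ((\<alpha> - 1) / 2) = p t powr (\<alpha> - 1)"
    using pp by (simp add: powr_powr diff_divide_distrib flip: powr_numeral)
  also have "p t * (p t powr (\<alpha> - 1) * (1 + z) powr ((\<alpha> - 1) / 2)) = p t powr \<alpha> * (1 + z) powr ((\<alpha> - 1) / 2)"
    using pp by (simp add: powr_diff)
  finally have "y t powr (1 / \<alpha>) = p t * (1 + z) powr ((\<alpha> - 1) / (2 * \<alpha>))"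
    using alpha z(1) pp by (simp add: powr_mult powr_powr)
  then have "p t = y t powr (1 / \<alpha>) * (1 + z) powr (- ((\<alpha> - 1) / (2 * \<alpha>)))"
    using z(1) by (simp add: powr_minus field_simps)
  also have "- ((\<alpha> - 1) / (2 * \<alpha>)) = (1 - \<alpha>) / (2 * \<alpha>)" using alpha by (simp add: field_simps)
  also have "y t = (1 / m) * t * (1 + - (e t / t))" using m assms by (simp add: e_def field_simps)
  also have "\<dots> powr (1 / \<alpha>) = A * t powr (1 / \<alpha>) * (1 + - (e t / t)) powr (1 / \<alpha>)"
    by (simp only: A_def powr_mult)
  finally show ?thesis by (simp add: z_def mult_ac)
qed

lemma p_leading: "((\<lambda>t. p t / t powr (1 / \<alpha>)) \<longlongrightarrow> A) at_top"
proof -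
  have "((\<lambda>t. A * ((1 + - (e t / t)) powr (1 / \<alpha>) * (1 + 1 / (p t)\<^sup>2) powr ((1 - \<alpha>) / (2 * \<alpha>))))
      \<longlongrightarrow> A * ((1 + - 0) powr (1 / \<alpha>) * (1 + 0) powr ((1 - \<alpha>) / (2 * \<alpha>)))) at_top"
    by (intro tendsto_intros e_over_t p_inverse_square) auto
  then have "((\<lambda>t. A * ((1 + - (e t / t)) powr (1 / \<alpha>) * (1 + 1 / (p t)\<^sup>2) powr ((1 - \<alpha>) / (2 * \<alpha>))))
      \<longlongrightarrow> A) at_top" by simp
  then show ?thesis
  proof (rule Lim_transform_eventually)
    show "eventually (\<lambda>t. A * ((1 + - (e t / t)) powr (1 / \<alpha>) * (1 + 1 / (p t)\<^sup>2) powr ((1 - \<alpha>) / (2 * \<alpha>)))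
      = p t / t powr (1 / \<alpha>)) at_top"
      using eventually_gt_at_top[of 0]
    proof eventually_elim
      case (elim t)
      show ?case by (subst (2) p_factored[OF elim]) (use elim in simp)
    qed
  qed
qed

lemma p_squared_leading: "((\<lambda>t. (p t)\<^sup>2 / t powr (2 / \<alpha>)) \<longlongrightarrow> A\<^sup>2) at_top"
proof (rule Lim_transform_eventually[OF tendsto_power[OF p_leading, of 2]])
  show "eventually (\<lambda>t. (p t / t powr (1 / \<alpha>))\<^sup>2 = (p t)\<^sup>2 / t powr (2 / \<alpha>)) at_top"
  proof (intro always_eventually allI)
    fix t :: real
    have "t powr (2 / \<alpha>) = (t powr (1 / \<alpha>))\<^sup>2" by (simp add: power2_eq_square flip: powr_add)
    then show "(p t / t powr (1 / \<alpha>))\<^sup>2 = (p t)\<^sup>2 / t powr (2 / \<alpha>)" by (simp add: power_divide)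
  qed
qed

lemma a_leading: "((\<lambda>t. t powr (2 / \<alpha> - 1) / a t) \<longlongrightarrow> 1 / (m * \<alpha> * A\<^sup>2)) at_top"
proof -
  have "((\<lambda>t. t powr (- (2 / \<alpha>))) \<longlongrightarrow> 0) at_top"
    using alpha by (intro tendsto_neg_powr filterlim_ident) auto
  then have "((\<lambda>t. 1 / (m * (t powr (- (2 / \<alpha>)) + \<alpha> * ((p t)\<^sup>2 / t powr (2 / \<alpha>))))) \<longlongrightarrow> 1 / (m * (0 + \<alpha> * A\<^sup>2))) at_top"
    using alpha m A_pos by (intro tendsto_intros p_squared_leading) auto
  then have "((\<lambda>t. 1 / (m * (t powr (- (2 / \<alpha>)) + \<alpha> * ((p t)\<^sup>2 / t powr (2 / \<alpha>))))) \<longlongrightarrow> 1 / (m * \<alpha> * A\<^sup>2)) at_top"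
    by (simp only: add_0 mult.assoc)
  then show ?thesis
  proof (rule Lim_transform_eventually)
    show "eventually (\<lambda>t. 1 / (m * (t powr (- (2 / \<alpha>)) + \<alpha> * ((p t)\<^sup>2 / t powr (2 / \<alpha>)))) = t powr (2 / \<alpha> - 1) / a t) at_top"
      using eventually_gt_at_top[of 0]
    proof eventually_elim
      case (elim t)
      have "t powr (- (2 / \<alpha>)) + \<alpha> * ((p t)\<^sup>2 / t powr (2 / \<alpha>)) = (1 + \<alpha> * (p t)\<^sup>2) / t powr (2 / \<alpha>)"
        by (simp add: powr_minus_divide add_divide_distrib)
      then show ?case using elim by (simp add: a_def powr_diff)
    qed
  qed
qed

text \<open>The relation \<open>a e \<longlongrightarrow> 1\<close> in explicit form: the weight
  \<open>t powr (2 / \<alpha> - 1)\<close> has the order of \<open>a\<close>, and differentiating it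
  contributes \<open>c = 2 / \<alpha> - 1\<close>.\<close>

lemma e_leading: "((\<lambda>t. e t * t powr (2 / \<alpha> - 1)) \<longlongrightarrow> 1 / (m * \<alpha> * A\<^sup>2)) at_top"
proof (rule attracting_linear_ode[OF a_cont ta_at_top a_leading, where c = "2 / \<alpha> - 1"])
  fix t :: real assume t: "t > 0"
  have "((\<lambda>t. e t * t powr (2 / \<alpha> - 1)) has_real_derivative
      (1 - a t * e t) * t powr (2 / \<alpha> - 1) + ((2 / \<alpha> - 1) * t powr (2 / \<alpha> - 1 - 1)) * e t) (at t)"
    using t by (intro DERIV_mult e_deriv has_real_derivative_powr)
  also have "t powr (2 / \<alpha> - 1 - 1) = t powr (2 / \<alpha> - 1) / t"
    using t by (simp add: powr_diff power2_eq_square)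
  also have "(1 - a t * e t) * t powr (2 / \<alpha> - 1) + ((2 / \<alpha> - 1) * (t powr (2 / \<alpha> - 1) / t)) * e t
    = a t * (t powr (2 / \<alpha> - 1) / a t - e t * t powr (2 / \<alpha> - 1)) + (2 / \<alpha> - 1) * (e t * t powr (2 / \<alpha> - 1)) / t"
    using a_pos[OF t] by (simp add: right_diff_distrib left_diff_distrib mult_ac)
  finally show "((\<lambda>t. e t * t powr (2 / \<alpha> - 1)) has_real_derivative
    a t * (t powr (2 / \<alpha> - 1) / a t - e t * t powr (2 / \<alpha> - 1)) + (2 / \<alpha> - 1) * (e t * t powr (2 / \<alpha> - 1)) / t) (at t)" .
qed

text \<open>Both corrections in \<open>p_factored\<close> are of order
  \<open>t powr (- 2 / \<alpha>)\<close>. The one from \<open>e / t\<close> contributes the summand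
  \<open>1 / (\<alpha> * m)\<close>, the one from \<open>1 / p^2\<close> the summand
  \<open>(\<alpha> - 1) / 2\<close>.\<close>

lemma slope_asymptotics:
  "((\<lambda>t. (p t - A * t powr (1 / \<alpha>)) * t powr (1 / \<alpha>)) \<longlongrightarrow>
     - (m powr (1 / \<alpha>) / \<alpha> * (1 / (\<alpha> * m) + (\<alpha> - 1) / 2))) at_top"
proof -
  define x where "x t = - (e t / t)" for t
  define z where "z t = 1 / (p t)\<^sup>2" for t
  define h where "h t = t powr (2 / \<alpha>)" for t :: real
  define \<gamma> where "\<gamma> = (1 - \<alpha>) / (2 * \<alpha>)"
  have x: "(x \<longlongrightarrow> 0) at_top" unfolding x_def using tendsto_minus[OF e_over_t] by simp
  have xh: "((\<lambda>t. x t * h t) \<longlongrightarrow> - (1 / (m * \<alpha> * A\<^sup>2))) at_top"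
    by (rule Lim_transform_eventually[OF tendsto_minus[OF e_leading]])
      (use eventually_gt_at_top[of 0] in eventually_elim, simp add: x_def h_def powr_diff)
  have z: "(z \<longlongrightarrow> 0) at_top" unfolding z_def by (rule p_inverse_square)
  have "((\<lambda>t. inverse ((p t)\<^sup>2 / t powr (2 / \<alpha>))) \<longlongrightarrow> inverse (A\<^sup>2)) at_top"
    using A_pos by (intro tendsto_inverse p_squared_leading) auto
  then have zh: "((\<lambda>t. z t * h t) \<longlongrightarrow> 1 / A\<^sup>2) at_top"
    by (simp add: z_def h_def divide_inverse mult_ac)
  \<comment> \<open>With \<open>X\<close>, \<open>Z\<close> the two correction factors,
    \<open>X Z - 1 = (X - 1) Z + (Z - 1)\<close> reduces the product to two first-order
    expansions.\<close>
  have "((\<lambda>t. A * (((1 + x t) powr (1 / \<alpha>) - 1) * h t * (1 + z t) powr \<gamma> + ((1 + z t) powr \<gamma> - 1) * h t))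
     \<longlongrightarrow> A * (1 / \<alpha> * (- (1 / (m * \<alpha> * A\<^sup>2))) * (1 + 0) powr \<gamma> + \<gamma> * (1 / A\<^sup>2))) at_top"
    by (intro tendsto_intros powr_first_order x xh z zh) auto
  moreover have "A * (1 / \<alpha> * (- (1 / (m * \<alpha> * A\<^sup>2))) * (1 + 0) powr \<gamma> + \<gamma> * (1 / A\<^sup>2))
    = - ((1 / A) / \<alpha> * (1 / (\<alpha> * m) + (\<alpha> - 1) / 2))"
    using A_pos alpha m by (simp add: \<gamma>_def field_simps power2_eq_square)
  moreover have "1 / A = m powr (1 / \<alpha>)" using m by (simp add: A_def powr_divide)
  ultimately have "((\<lambda>t. A * (((1 + x t) powr (1 / \<alpha>) - 1) * h t * (1 + z t) powr \<gamma> + ((1 + z t) powr \<gamma> - 1) * h t))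
     \<longlongrightarrow> - (m powr (1 / \<alpha>) / \<alpha> * (1 / (\<alpha> * m) + (\<alpha> - 1) / 2))) at_top" by simp
  then show ?thesis
  proof (rule Lim_transform_eventually)
    show "eventually (\<lambda>t. A * (((1 + x t) powr (1 / \<alpha>) - 1) * h t * (1 + z t) powr \<gamma> + ((1 + z t) powr \<gamma> - 1) * h t)
       = (p t - A * t powr (1 / \<alpha>)) * t powr (1 / \<alpha>)) at_top"
      using eventually_gt_at_top[of 0]
    proof eventually_elim
      case (elim t)
      have "h t = t powr (1 / \<alpha>) * t powr (1 / \<alpha>)" by (simp add: h_def flip: powr_add)
      moreover have "p t = A * t powr (1 / \<alpha>) * ((1 + x t) powr (1 / \<alpha>) * (1 + z t) powr \<gamma>)"
        unfolding x_def z_def \<gamma>_def by (rule p_factored[OF elim])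
      then have "(p t - A * t powr (1 / \<alpha>)) * t powr (1 / \<alpha>) =
         A * (t powr (1 / \<alpha>) * t powr (1 / \<alpha>)) * ((1 + x t) powr (1 / \<alpha>) * (1 + z t) powr \<gamma> - 1)"
        by (simp only:) (simp add: algebra_simps)
      moreover have "A * (((1 + x t) powr (1 / \<alpha>) - 1) * h t * (1 + z t) powr \<gamma> + ((1 + z t) powr \<gamma> - 1) * h t)
        = A * h t * ((1 + x t) powr (1 / \<alpha>) * (1 + z t) powr \<gamma> - 1)"
        by (simp add: algebra_simps)
      ultimately show ?case by (simp only:)
    qed
  qed
qed

text \<open>For \<alpha> = 1 one has \<open>y = p\<close>, so \<open>p = (t - e) / m\<close>
  exactly, and the next term of \<open>p\<close> is that of \<open>e\<close> after
  \<open>m / t\<close>. The remainder \<open>e - m / t\<close>, weighted by \<open>t^3\<close>,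
  satisfies an equation of the same attracting type, with \<open>c = 3\<close>.\<close>

lemma slope_asymptotics_1:
  assumes "\<alpha> = 1"
  shows "((\<lambda>t. (p t - t / m + 1 / t) * t ^ 3) \<longlongrightarrow> real m * (real m - 3)) at_top"
proof -
  have A1: "A = 1 / m" unfolding A_def using assms by simp
  have lim: "1 / (m * \<alpha> * A\<^sup>2) = m" unfolding A1 using assms by (simp add: power2_eq_square)
  have exponent: "2 / \<alpha> - 1 = 1" using assms by simp
  have ta: "((\<lambda>t. t / a t) \<longlongrightarrow> m) at_top"
    by (rule Lim_transform_eventually[OF a_leading[unfolded lim exponent]])
      (use eventually_gt_at_top[of 0] in eventually_elim, simp)
  have te: "((\<lambda>t. t * e t) \<longlongrightarrow> m) at_top"
    by (rule Lim_transform_eventually[OF e_leading[unfolded lim exponent]])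
      (use eventually_gt_at_top[of 0] in eventually_elim, simp)
  have "((\<lambda>t. (t * e t) * inverse t) \<longlongrightarrow> real m * 0) at_top"
    by (intro tendsto_mult te tendsto_inverse_0_at_top filterlim_ident)
  then have e0: "(e \<longlongrightarrow> 0) at_top"
    unfolding mult_zero_right
    by (rule Lim_transform_eventually) (use eventually_gt_at_top[of 0] in eventually_elim, simp)
  have "y t = p t" for t unfolding y_def using assms by simp
  then have py: "p t = (t - e t) / m" for t using m by (simp add: e_def)
  have "((\<lambda>t. (e t - m / t) * t ^ 3) \<longlongrightarrow> real m * (real m - (real m)\<^sup>2 + 2 * real m - 0\<^sup>2)) at_top"
  proof (rule attracting_linear_ode[OF a_cont ta_at_top, where c = 3
        and l = "\<lambda>t. (t / a t) * (real m - (real m)\<^sup>2 + 2 * (t * e t) - (e t)\<^sup>2)"])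
    show "((\<lambda>t. (t / a t) * (real m - (real m)\<^sup>2 + 2 * (t * e t) - (e t)\<^sup>2)) \<longlongrightarrow>
      real m * (real m - (real m)\<^sup>2 + 2 * real m - 0\<^sup>2)) at_top"
      by (intro tendsto_intros ta te e0)
    fix t :: real assume t: "t > 0"
    \<comment> \<open>This is the residual of \<open>m / t\<close> in the equation for
      \<open>e\<close>. Inserting \<open>m p = t - e\<close> into \<open>a\<close> cancels the cubic
      terms and leaves an expression of order \<open>t\<close>, the order of
      \<open>a\<close>.\<close>
    have key: "t ^ 3 * (1 - a t * m / t + m / t\<^sup>2) = t * (real m - (real m)\<^sup>2 + 2 * (t * e t) - (e t)\<^sup>2)"
    proof -
      have "a t = m * (1 + (p t)\<^sup>2) / t" unfolding a_def using assms by simp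
      then have "a t * m / t = ((real m)\<^sup>2 + (m * p t)\<^sup>2) / t\<^sup>2"
        using t by (simp add: field_simps power2_eq_square)
      also have "m * p t = t - e t" by (simp add: py)
      finally have "a t * m / t = ((real m)\<^sup>2 + (t - e t)\<^sup>2) / t\<^sup>2" .
      moreover have "t ^ 3 * (1 - X / t\<^sup>2 + m / t\<^sup>2) = t ^ 3 - t * X + t * m" for X
        using t by (simp add: field_simps power2_eq_square power3_eq_cube)
      ultimately have "t ^ 3 * (1 - a t * m / t + m / t\<^sup>2) = t ^ 3 - t * ((real m)\<^sup>2 + (t - e t)\<^sup>2) + t * m"
        by simp
      then show ?thesis by (simp add: algebra_simps power2_eq_square power3_eq_cube)
    qed
    have "((\<lambda>t. (e t - m / t) * t ^ 3) has_real_derivative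
       ((1 - a t * e t + m / t\<^sup>2) * t ^ 3 + (3 * t\<^sup>2) * (e t - m / t))) (at t)"
      using t by (auto intro!: derivative_eq_intros e_deriv simp: power2_eq_square)
    also have "(1 - a t * e t + m / t\<^sup>2) * t ^ 3 + (3 * t\<^sup>2) * (e t - m / t) =
      t ^ 3 * (1 - a t * m / t + m / t\<^sup>2) - a t * ((e t - m / t) * t ^ 3) + 3 * ((e t - m / t) * t ^ 3) / t"
      using t by (simp add: field_simps power2_eq_square power3_eq_cube)
    also have "t ^ 3 * (1 - a t * m / t + m / t\<^sup>2) =
        a t * ((t / a t) * (real m - (real m)\<^sup>2 + 2 * (t * e t) - (e t)\<^sup>2))"
      unfolding key using a_pos[OF t] by simp
    finally show "((\<lambda>t. (e t - m / t) * t ^ 3) has_real_derivative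
      a t * ((t / a t) * (real m - (real m)\<^sup>2 + 2 * (t * e t) - (e t)\<^sup>2) - (e t - m / t) * t ^ 3)
        + 3 * ((e t - m / t) * t ^ 3) / t) (at t)"
      by (simp only: right_diff_distrib)
  qed
  then have "((\<lambda>t. - ((e t - m / t) * t ^ 3) / m) \<longlongrightarrow> - (real m * (real m - (real m)\<^sup>2 + 2 * real m - 0\<^sup>2)) / m) at_top"
    by (rule tendsto_divide[OF tendsto_minus tendsto_const]) simp
  moreover have "- (real m * (real m - (real m)\<^sup>2 + 2 * real m - 0\<^sup>2)) / m = real m * (real m - 3)"
    using m by (simp add: field_simps power2_eq_square)
  moreover have "- ((e t - m / t) * t ^ 3) / m = (p t - t / m + 1 / t) * t ^ 3" for t
    using m by (simp add: py diff_divide_distrib algebra_simps)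
  ultimately show ?thesis by simp
qed

end

section \<open>Existence of the slope\<close>

text \<open>The fixed point is sought for \<open>e\<^sup>-\<^sup>\<mu>\<^sup>|\<^sup>t\<^sup>| s(t)\<close> among the bounded continuous functions on the line:
  this weight makes the Picard operator a contraction, and the form
  \<open>s(t) = t \<integral>\<^sub>0\<^sup>1 \<xi>\<^sup>m g(s(t\<xi>)) d\<xi>\<close> of the equation is not singular at \<open>0\<close>.\<close>

lemma flux_equation_Lipschitz_exists:
  fixes g :: "real \<Rightarrow> real" and m :: nat
  assumes bound: "\<And>x. \<bar>g x\<bar> \<le> M" and lip: "\<And>x y. \<bar>g x - g y\<bar> \<le> L * \<bar>x - y\<bar>"
  shows "\<exists>s. continuous_on UNIV s \<and> s 0 = 0 \<and>
    (\<forall>t>0. ((\<lambda>t. t ^ m * s t) has_real_derivative t ^ m * g (s t)) (at t))"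
proof -
  have L0: "L \<ge> 0" using lip[of 0 1] by simp
  have gcont: "continuous_on UNIV g"
    by (rule lipschitz_on_continuous_on[of L]) (use lip L0 in \<open>auto simp: lipschitz_on_def dist_real_def\<close>)
  \<comment> \<open>Chosen so that \<open>L / \<mu> \<le> 1 / 2\<close>, the contraction constant
    used below.\<close>
  define \<mu> where "\<mu> = 2 * L + 1"
  have lam: "\<mu> > 0" "L / \<mu> \<le> 1 / 2" using L0 by (auto simp: \<mu>_def field_simps)
  define w where "w t = exp (\<mu> * \<bar>t\<bar>)" for t
  define I where "I z t = integral {0..1} (\<lambda>\<xi>. \<xi> ^ m * g (w (t * \<xi>) * z (t * \<xi>)))" for z :: "real \<Rightarrow> real" and t
  have wpos: "w t > 0" for t by (simp add: w_def)
  have wcont: "continuous_on A (\<lambda>x. w (f x))" if "continuous_on A f" for A :: "'b::topological_space set" and f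
    unfolding w_def using that by (intro continuous_intros)
  have gcomp: "continuous_on A (\<lambda>x. g (f x))" if "continuous_on A f" for A :: "'b::topological_space set" and f
    using continuous_on_compose2[OF gcont that] by simp
  have integrand_cont: "continuous_on {0..1} (\<lambda>\<xi>. \<xi> ^ m * g (w (t * \<xi>) * z (t * \<xi>)))"
    if "continuous_on UNIV z" for z t
    by (intro continuous_intros gcomp wcont continuous_on_compose2[OF that]) auto
  have I_cont: "continuous_on UNIV (I z)" if "continuous_on UNIV z" for z
  proof -
    have "continuous_on UNIV (\<lambda>t. integral (cbox 0 1) (\<lambda>\<xi>. \<xi> ^ m * g (w (t * \<xi>) * z (t * \<xi>))))"
      by (rule integral_continuous_on_param)
        (auto simp: case_prod_beta intro!: continuous_intros gcomp wcont continuous_on_compose2[OF that])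
    then show ?thesis by (simp add: I_def[abs_def])
  qed
  have I_bound: "\<bar>I z t\<bar> \<le> M" if "continuous_on UNIV z" for z t
  proof -
    have "norm (I z t) \<le> integral {0..1} (\<lambda>\<xi>::real. M)"
      unfolding I_def
    proof (rule integral_norm_bound_integral)
      show "(\<lambda>\<xi>. \<xi> ^ m * g (w (t * \<xi>) * z (t * \<xi>))) integrable_on {0..1}"
        by (rule integrable_continuous_real[OF integrand_cont[OF that]])
      fix \<xi> :: real assume "\<xi> \<in> {0..1}"
      then show "norm (\<xi> ^ m * g (w (t * \<xi>) * z (t * \<xi>))) \<le> M"
        using mult_mono[of "\<xi> ^ m" 1 "\<bar>g (w (t * \<xi>) * z (t * \<xi>))\<bar>" M] bound
        by (simp add: abs_mult power_le_one)
    qed auto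
    then show ?thesis by simp
  qed
  have tw: "\<bar>t\<bar> / w t \<le> 1 / \<mu>" for t
  proof -
    have "\<mu> * \<bar>t\<bar> \<le> w t" unfolding w_def using exp_ge_add_one_self[of "\<mu> * \<bar>t\<bar>"] by linarith
    then show ?thesis using lam wpos[of t] by (simp add: field_simps)
  qed
  \<comment> \<open>Dividing by the weight compensates the growth of \<open>t * I z t\<close>, so
    the operator maps into bounded functions.\<close>
  have in_bcontfun: "(\<lambda>t. t / w t * I z t) \<in> bcontfun" if z: "continuous_on UNIV z" for z
  proof (rule bcontfun_normI)
    show "continuous_on UNIV (\<lambda>t. t / w t * I z t)"
      using wpos by (intro continuous_intros wcont I_cont[OF z]) (auto simp: less_imp_neq[symmetric])
    show "norm (t / w t * I z t) \<le> 1 / \<mu> * M" for t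
    proof -
      have "M \<ge> 0" using bound[of 0] by linarith
      then show ?thesis using mult_mono[OF tw[of t] I_bound[OF z, of t]] lam wpos[of t]
        by (simp add: abs_mult)
    qed
  qed
  define \<Phi> where "\<Phi> z = Bcontfun (\<lambda>t. t / w t * I (apply_bcontfun z) t)" for z
  have Phi: "apply_bcontfun (\<Phi> z) t = t / w t * I (apply_bcontfun z) t" for z t
    unfolding \<Phi>_def by (subst Bcontfun_inverse[OF in_bcontfun]) auto
  have contraction: "dist (\<Phi> z1) (\<Phi> z2) \<le> 1 / 2 * dist z1 z2" for z1 z2
  proof (rule dist_bound)
    fix t :: real
    define d where "d = dist z1 z2"
    have zd: "\<bar>z1 x - z2 x\<bar> \<le> d" for x using dist_bounded[of z1 x z2] by (simp add: d_def dist_real_def)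
    have zc: "continuous_on UNIV (apply_bcontfun z1)" "continuous_on UNIV (apply_bcontfun z2)" by auto
    \<comment> \<open>Integrating the exponential weight gains the factor \<open>1 / \<mu>\<close>:
      the value is \<open>(w t - 1) / \<mu>\<close>.\<close>
    have E: "((\<lambda>\<xi>. \<bar>t\<bar> * exp (\<mu> * \<bar>t\<bar> * \<xi>)) has_integral exp (\<mu> * \<bar>t\<bar> * 1) / \<mu> - exp (\<mu> * \<bar>t\<bar> * 0) / \<mu>) {0..1}"
    proof (rule fundamental_theorem_of_calculus)
      fix \<xi> :: real
      have "((\<lambda>\<xi>. exp (\<mu> * \<bar>t\<bar> * \<xi>) / \<mu>) has_real_derivative \<bar>t\<bar> * exp (\<mu> * \<bar>t\<bar> * \<xi>)) (at \<xi>)"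
        using lam by (auto intro!: derivative_eq_intros)
      then show "((\<lambda>\<xi>. exp (\<mu> * \<bar>t\<bar> * \<xi>) / \<mu>) has_vector_derivative \<bar>t\<bar> * exp (\<mu> * \<bar>t\<bar> * \<xi>)) (at \<xi> within {0..1})"
        by (simp add: has_real_derivative_iff_has_vector_derivative has_vector_derivative_at_within)
    qed simp
    have "\<bar>t\<bar> * \<bar>I z1 t - I z2 t\<bar> = norm (integral {0..1} (\<lambda>\<xi>. t * (\<xi> ^ m * g (w (t * \<xi>) * z1 (t * \<xi>)) - \<xi> ^ m * g (w (t * \<xi>) * z2 (t * \<xi>)))))"
      unfolding I_def
      by (subst integral_mult_right, subst integral_diff)
        (auto intro!: integrable_continuous_real integrand_cont zc simp: abs_mult)
    also have "\<dots> \<le> integral {0..1} (\<lambda>\<xi>. L * d * (\<bar>t\<bar> * exp (\<mu> * \<bar>t\<bar> * \<xi>)))"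
    proof (rule integral_norm_bound_integral)
      show "(\<lambda>\<xi>. t * (\<xi> ^ m * g (w (t * \<xi>) * z1 (t * \<xi>)) - \<xi> ^ m * g (w (t * \<xi>) * z2 (t * \<xi>)))) integrable_on {0..1}"
        by (intro integrable_continuous_real continuous_on_mult_left continuous_on_diff integrand_cont zc)
      show "(\<lambda>\<xi>. L * d * (\<bar>t\<bar> * exp (\<mu> * \<bar>t\<bar> * \<xi>))) integrable_on {0..1}"
        by (intro integrable_continuous_real continuous_intros)
      fix \<xi> :: real assume xi: "\<xi> \<in> {0..1}"
      have "\<bar>g (w (t * \<xi>) * z1 (t * \<xi>)) - g (w (t * \<xi>) * z2 (t * \<xi>))\<bar> \<le> L * (w (t * \<xi>) * \<bar>z1 (t * \<xi>) - z2 (t * \<xi>)\<bar>)"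
        using lip[of "w (t * \<xi>) * z1 (t * \<xi>)" "w (t * \<xi>) * z2 (t * \<xi>)"] wpos[of "t * \<xi>"]
        by (simp add: abs_mult flip: right_diff_distrib)
      also have "\<dots> \<le> L * (w (t * \<xi>) * d)" using zd[of "t * \<xi>"] L0 wpos[of "t * \<xi>"] by (intro mult_left_mono) auto
      finally have "\<xi> ^ m * \<bar>g (w (t * \<xi>) * z1 (t * \<xi>)) - g (w (t * \<xi>) * z2 (t * \<xi>))\<bar> \<le> 1 * (L * (w (t * \<xi>) * d))"
        using xi by (intro mult_mono power_le_one) auto
      then have "\<bar>t\<bar> * (\<xi> ^ m * \<bar>g (w (t * \<xi>) * z1 (t * \<xi>)) - g (w (t * \<xi>) * z2 (t * \<xi>))\<bar>) \<le> \<bar>t\<bar> * (1 * (L * (w (t * \<xi>) * d)))"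
        by (rule mult_left_mono) simp
      moreover have "w (t * \<xi>) = exp (\<mu> * \<bar>t\<bar> * \<xi>)" using xi by (simp add: w_def abs_mult)
      ultimately show "norm (t * (\<xi> ^ m * g (w (t * \<xi>) * z1 (t * \<xi>)) - \<xi> ^ m * g (w (t * \<xi>) * z2 (t * \<xi>)))) \<le> L * d * (\<bar>t\<bar> * exp (\<mu> * \<bar>t\<bar> * \<xi>))"
        using xi by (simp add: abs_mult mult_ac flip: right_diff_distrib)
    qed
    also have "\<dots> = L * d * ((w t - 1) / \<mu>)"
      using integral_unique[OF E] by (simp add: w_def diff_divide_distrib)
    also have "\<dots> = (L / \<mu>) * (d * (w t - 1))" by simp
    also have "\<dots> \<le> 1 / 2 * (d * w t)"
      using lam L0 zero_le_dist[of z1 z2] one_le_exp_iff[of "\<mu> * \<bar>t\<bar>"]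
      unfolding d_def w_def by (intro mult_mono) auto
    finally have "\<bar>t\<bar> * \<bar>I z1 t - I z2 t\<bar> / w t \<le> 1 / 2 * d" using wpos[of t] by (simp add: field_simps)
    moreover have "\<Phi> z1 t - \<Phi> z2 t = t / w t * (I z1 t - I z2 t)"
      by (simp only: Phi right_diff_distrib)
    ultimately show "dist (\<Phi> z1 t) (\<Phi> z2 t) \<le> 1 / 2 * dist z1 z2"
      using wpos[of t] by (simp add: dist_real_def d_def abs_mult)
  qed
  have "\<exists>!z. \<Phi> z = z"
    by (rule banach_fix_type[of "1 / 2"]) (use contraction in auto)
  then obtain z where z: "\<Phi> z = z" by blast
  define s where "s t = w t * z t" for t
  have s: "s t = t * integral {0..1} (\<lambda>\<xi>. \<xi> ^ m * g (s (t * \<xi>)))" for t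
    using Phi[of z t] wpos[of t] by (simp add: z s_def I_def)
  have s_cont: "continuous_on UNIV s"
    unfolding s_def by (intro continuous_intros wcont) auto
  define h where "h t = t ^ m * g (s t)" for t
  have h_cont: "continuous_on A h" for A
    unfolding h_def
    by (intro continuous_intros gcomp continuous_on_subset[OF s_cont]) auto
  define G where "G t = integral {0..t} h" for t
  have G_deriv: "(G has_real_derivative h t) (at t within {0..T})" if "0 \<le> t" "t \<le> T" for t T
    unfolding G_def using integral_has_real_derivative[OF h_cont[of "{0..T}"], of t] that by auto
  \<comment> \<open>The substitution of \<open>t * \<xi>\<close> for the integration variable turns
    the rescaled fixed point equation back into the integrated flux equation.\<close>
  have flux: "t ^ m * s t = G t" if t: "t \<ge> 0" for t
  proof -
    have "((\<lambda>\<xi>. h (t * \<xi>) * t) has_integral (G (t * 1) - G (t * 0))) {0..1}"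
    proof (rule fundamental_theorem_of_calculus)
      fix \<xi> :: real assume xi: "\<xi> \<in> {0..1}"
      have "(G has_real_derivative h (t * \<xi>)) (at (t * \<xi>) within (\<lambda>\<xi>. t * \<xi>) ` {0..1})"
        by (rule DERIV_subset[OF G_deriv[of "t * \<xi>" t]])
          (use xi t in \<open>auto intro: mult_left_le\<close>)
      from DERIV_image_chain[OF this, of t]
      have "(G \<circ> (\<lambda>\<xi>. t * \<xi>) has_real_derivative h (t * \<xi>) * t) (at \<xi> within {0..1})"
        by (auto intro!: derivative_eq_intros)
      then show "((\<lambda>\<xi>. G (t * \<xi>)) has_vector_derivative h (t * \<xi>) * t) (at \<xi> within {0..1})"
        by (simp add: has_real_derivative_iff_has_vector_derivative o_def)
    qed simp
    from integral_unique[OF this] have "integral {0..1} (\<lambda>\<xi>. h (t * \<xi>) * t) = G t - G 0" by simp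
    moreover have "G 0 = 0" by (simp add: G_def)
    moreover have "(\<lambda>\<xi>. h (t * \<xi>) * t) = (\<lambda>\<xi>. (t ^ m * t) * (\<xi> ^ m * g (s (t * \<xi>))))"
      by (simp add: h_def power_mult_distrib mult_ac fun_eq_iff)
    moreover have "t ^ m * s t = (t ^ m * t) * integral {0..1} (\<lambda>\<xi>. \<xi> ^ m * g (s (t * \<xi>)))"
      by (subst s) simp
    ultimately show ?thesis by simp
  qed
  have "((\<lambda>t. t ^ m * s t) has_real_derivative t ^ m * g (s t)) (at t)" if "t > 0" for t
  proof -
    have "at t within {0..t + 1} = at t" using that by (intro at_within_interior) auto
    then have "(G has_real_derivative t ^ m * g (s t)) (at t)"
      using G_deriv[of t "t + 1"] that by (simp add: h_def)
    then show ?thesis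
    proof (rule has_field_derivative_transform_within_open[of _ _ _ "{0<..}"])
      show "\<And>x. x \<in> {0<..} \<Longrightarrow> G x = x ^ m * s x" using flux by simp
    qed (use that in auto)
  qed
  moreover have "s 0 = 0" by (subst s) simp
  ultimately show ?thesis using s_cont by blast
qed

section \<open>Removing the cut-off and passing to the half-line\<close>

lemma DERIV_of_flux:
  fixes s :: "real \<Rightarrow> real" and m :: nat
  assumes "m \<ge> 1" "t > 0" and flux: "((\<lambda>t. t ^ m * s t) has_real_derivative t ^ m * d) (at t)"
  shows "(s has_real_derivative d - m * s t / t) (at t)"
proof -
  have "((\<lambda>t. (t ^ m * s t) / t ^ m) has_real_derivative
    (t ^ m * d * t ^ m - t ^ m * s t * (real m * t ^ (m - 1))) / (t ^ m * t ^ m)) (at t)"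
    using \<open>t > 0\<close> DERIV_pow[of m t] by (intro DERIV_divide flux) auto
  also have "(t ^ m * d * t ^ m - t ^ m * s t * (real m * t ^ (m - 1))) / (t ^ m * t ^ m) = d - m * s t / t"
  proof -
    have "t ^ m = t ^ (m - 1) * t" using \<open>m \<ge> 1\<close> by (simp flip: power_Suc2)
    then show ?thesis using \<open>t > 0\<close> by (simp add: field_simps)
  qed
  finally show ?thesis
    by (rule has_field_derivative_transform_within_open[of _ _ _ "{0<..}"]) (use \<open>t > 0\<close> in auto)
qed

text \<open>For \<alpha> < 2 the derivative of \<open>F\<close> is unbounded near \<open>1\<close>,
  so \<open>F\<close> is replaced by its composition with the clamp to \<open>[0, \<sigma>]\<close>.
  The solution of the modified equation stays in that interval up to \<open>T\<close>, hence solves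
  the original one there.\<close>

lemma flux_equation_exists_on_interval:
  fixes m :: nat
  assumes "\<alpha> > 0" "m \<ge> 1" "T > 0"
  shows "\<exists>s. continuous_on UNIV s \<and> s 0 = 0 \<and> (\<forall>t. 0 \<le> t \<and> t \<le> T \<longrightarrow> 0 \<le> s t \<and> s t < 1) \<and>
    (\<forall>t. 0 < t \<and> t \<le> T \<longrightarrow>
      ((\<lambda>t. t ^ m * s t) has_real_derivative t ^ m * (1 - (s t)\<^sup>2) powr (\<alpha> / 2)) (at t))"
proof -
  define F where "F u = (1 - u\<^sup>2) powr (\<alpha> / 2)" for u :: real
  \<comment> \<open>\<open>\<sigma>\<close> is so close to 1 that \<open>F \<sigma> \<le> m / (2 T) \<le> m \<sigma> / t\<close> for \<open>t \<le> T\<close>; hence \<open>s\<close> cannot rise above it.\<close>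
  define k where "k = m / (2 * T)"
  have k: "k > 0" using assms by (simp add: k_def)
  \<comment> \<open>The bound \<open>3 / 4\<close> ensures \<sigma> \<ge> 1 / 2; the other one
    ensures \<open>F \<sigma> = \<delta> powr (\<alpha> / 2) \<le> k\<close>.\<close>
  define \<delta> where "\<delta> = min (3 / 4) (k powr (2 / \<alpha>))"
  define \<sigma> where "\<sigma> = sqrt (1 - \<delta>)"
  have del: "0 < \<delta>" "\<delta> \<le> 3 / 4" "\<delta> \<le> k powr (2 / \<alpha>)" using k by (auto simp: \<delta>_def)
  have sig2: "\<sigma>\<^sup>2 = 1 - \<delta>" using del by (simp add: \<sigma>_def)
  have "sqrt (1 / 4) \<le> \<sigma>" unfolding \<sigma>_def using del by (intro real_sqrt_le_mono) simp
  then have sig: "1 / 2 \<le> \<sigma>" "\<sigma> < 1" using del by (auto simp: \<sigma>_def real_sqrt_divide)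
  have "F \<sigma> = \<delta> powr (\<alpha> / 2)" by (simp add: F_def sig2)
  also have "\<dots> \<le> (k powr (2 / \<alpha>)) powr (\<alpha> / 2)" using del \<open>\<alpha> > 0\<close> by (intro powr_mono2) auto
  also have "\<dots> = k" using \<open>\<alpha> > 0\<close> k by (simp add: powr_powr)
  finally have Fsig: "F \<sigma> \<le> k" .
  define F' where "F' u = (\<alpha> / 2) * (1 - u\<^sup>2) powr (\<alpha> / 2 - 1) * (- (2 * u))" for u :: real
  have pos: "1 - u\<^sup>2 > 0" if "u \<in> {0..\<sigma>}" for u
  proof -
    have "u\<^sup>2 \<le> \<sigma>\<^sup>2" using that by (intro power_mono) auto
    then show ?thesis using sig2 del by simp
  qed
  have F_deriv: "(F has_real_derivative F' u) (at u)" if "u \<in> {0..\<sigma>}" for u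
    unfolding F_def F'_def using pos[OF that]
    by (intro DERIV_fun_powr[of _ _ _ "\<alpha> / 2", simplified of_nat_1]) (auto intro!: derivative_eq_intros)
  have "continuous_on {0..\<sigma>} F'"
    unfolding F'_def by (intro continuous_intros) (use pos in force)
  then have "bounded (F' ` {0..\<sigma>})" by (intro compact_imp_bounded compact_continuous_image) auto
  then obtain L where "\<forall>u\<in>{0..\<sigma>}. \<bar>F' u\<bar> \<le> L" by (auto simp: bounded_iff)
  then have L: "\<bar>F' u\<bar> \<le> L" if "u \<in> {0..\<sigma>}" for u using that by blast
  define cl where "cl x = max 0 (min x \<sigma>)" for x
  have cl: "cl x \<in> {0..\<sigma>}" for x using sig by (auto simp: cl_def)
  have clid: "cl x = x" if "x \<in> {0..\<sigma>}" for x using that by (auto simp: cl_def)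
  define g where "g x = F (cl x)" for x
  have gnn: "g x \<ge> 0" for x by (simp add: g_def F_def)
  have "g x \<le> 1" for x unfolding g_def F_def
    using pos[OF cl[of x]] \<open>\<alpha> > 0\<close> zero_le_power2[of "cl x"] by (intro powr_le1) linarith+
  with gnn have "\<bar>g x\<bar> \<le> 1" for x by simp
  moreover have "\<bar>g x - g y\<bar> \<le> L * \<bar>x - y\<bar>" for x y
  proof -
    have "norm (F (cl x) - F (cl y)) \<le> L * norm (cl x - cl y)"
      by (rule field_differentiable_bound[of "{0..\<sigma>}" F F'])
        (use cl L F_deriv in \<open>auto intro: has_field_derivative_at_within\<close>)
    also have "\<dots> \<le> L * norm (x - y)"
      using L[OF cl[of 0]] by (intro mult_left_mono) (auto simp: cl_def)
    finally show ?thesis by (simp add: g_def)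
  qed
  ultimately obtain s where s: "continuous_on UNIV s" "s 0 = 0"
    and flux: "\<And>t. t > 0 \<Longrightarrow> ((\<lambda>t. t ^ m * s t) has_real_derivative t ^ m * g (s t)) (at t)"
    using flux_equation_Lipschitz_exists[of g 1 L m] by auto
  have nonneg: "s t \<ge> 0" if "t \<ge> 0" for t
  proof (cases "t = 0")
    case False
    have "0 ^ m * s 0 \<le> t ^ m * s t"
    proof (rule DERIV_nonneg_imp_increasing_open[of 0 t "\<lambda>t. t ^ m * s t"])
      fix x assume "0 < x" "x < t"
      then show "\<exists>y. ((\<lambda>t. t ^ m * s t) has_real_derivative y) (at x) \<and> 0 \<le> y"
        using flux[of x] gnn[of "s x"] by (intro exI[of _ "x ^ m * g (s x)"]) auto
    qed (use that s in \<open>auto intro!: continuous_intros intro: continuous_on_subset\<close>)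
    moreover have "t ^ m > 0" using False that by simp
    ultimately show ?thesis by (auto simp: s zero_le_mult_iff)
  qed (simp add: s)
  have deriv: "(s has_real_derivative g (s t) - m * s t / t) (at t)" if "t > 0" for t
    by (rule DERIV_of_flux[OF assms(2) that flux[OF that]])
  have le: "s t \<le> \<sigma>" if t: "0 \<le> t" "t \<le> T" for t
  proof (rule ccontr)
    assume gt: "\<not> s t \<le> \<sigma>"
    \<comment> \<open>\<open>Sup Z\<close> is the last point before \<open>t\<close> with
      \<open>s \<le> \<sigma>\<close>. Beyond it
      \<open>s' = F \<sigma> - m s / x \<le> F \<sigma> - k \<le> 0\<close>, so \<open>s\<close>
      could not have risen to \<open>s t > \<sigma>\<close>.\<close>
    define Z where "Z = {x \<in> {0..t}. s x \<le> \<sigma>}"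
    have "closed Z" unfolding Z_def
      using continuous_on_closed_Collect_le[of "{0..t}" s "\<lambda>_. \<sigma>"] continuous_on_subset[OF s(1)] by simp
    moreover have "0 \<in> Z" "bdd_above Z" using t s sig by (auto simp: Z_def intro!: bdd_aboveI[of _ t])
    ultimately have Zin: "Sup Z \<in> Z" by (intro closed_contains_Sup) auto
    define z where "z = Sup Z"
    have z: "0 \<le> z" "z \<le> t" "s z \<le> \<sigma>" using Zin by (auto simp: Z_def z_def)
    have after: "s x > \<sigma>" if "z < x" "x \<le> t" for x
    proof (rule ccontr)
      assume "\<not> s x > \<sigma>"
      then have "x \<in> Z" using that z by (auto simp: Z_def)
      then have "x \<le> z" unfolding z_def by (rule cSup_upper) fact
      then show False using that by simp
    qed
    have "s t \<le> s z"
    proof (rule DERIV_nonpos_imp_decreasing_open[OF z(2)])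
      fix x assume x: "z < x" "x < t"
      have "s x > \<sigma>" using after x by simp
      then have "g (s x) = F \<sigma>" using sig by (simp add: g_def cl_def)
      moreover have "k \<le> m * s x / x"
      proof -
        have "k * x \<le> k * T" using x t k by (intro mult_left_mono) auto
        also have "\<dots> = m * (1 / 2)" using \<open>T > 0\<close> by (simp add: k_def)
        also have "\<dots> \<le> m * s x" using \<open>s x > \<sigma>\<close> sig by (intro mult_left_mono) auto
        finally show ?thesis using x z by (simp add: field_simps)
      qed
      ultimately show "\<exists>y. (s has_real_derivative y) (at x) \<and> y \<le> 0"
        using deriv[of x] Fsig x z by (intro exI[of _ "g (s x) - m * s x / x"]) auto
    qed (use s(1) in \<open>auto intro: continuous_on_subset\<close>)
    with z gt show False by simp
  qed
  have "g (s t) = F (s t)" if "0 \<le> t" "t \<le> T" for t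
    using nonneg le that by (simp add: g_def clid)
  then show ?thesis
    using s nonneg le sig flux by (intro exI[of _ s]) (auto simp: F_def less_imp_le intro: order.strict_trans1, force)
qed

text \<open>The level of the cut-off depends on \<open>T\<close>, so the global solution is glued
  from solutions on bounded intervals, which agree on overlaps by
  \<open>flux_equation_unique\<close>.\<close>

lemma flux_equation_exists:
  fixes m :: nat
  assumes "\<alpha> > 0" "m \<ge> 1"
  shows "\<exists>s. continuous_on {0..} s \<and> s 0 = 0 \<and> (\<forall>t\<ge>0. 0 \<le> s t \<and> s t < 1) \<and>
    (\<forall>t>0. ((\<lambda>t. t ^ m * s t) has_real_derivative t ^ m * (1 - (s t)\<^sup>2) powr (\<alpha> / 2)) (at t))"
proof -
  have "\<forall>T. \<exists>s. T > 0 \<longrightarrow> continuous_on UNIV s \<and> s 0 = 0 \<and> (\<forall>t. 0 \<le> t \<and> t \<le> T \<longrightarrow> 0 \<le> s t \<and> s t < 1) \<and>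
    (\<forall>t. 0 < t \<and> t \<le> T \<longrightarrow>
      ((\<lambda>t. t ^ m * s t) has_real_derivative t ^ m * (1 - (s t)\<^sup>2) powr (\<alpha> / 2)) (at t))"
    using flux_equation_exists_on_interval[OF assms] by blast
  from choice[OF this] obtain S where S0: "\<And>T. T > 0 \<longrightarrow> continuous_on UNIV (S T) \<and> S T 0 = 0 \<and>
    (\<forall>t. 0 \<le> t \<and> t \<le> T \<longrightarrow> 0 \<le> S T t \<and> S T t < 1) \<and>
    (\<forall>t. 0 < t \<and> t \<le> T \<longrightarrow>
      ((\<lambda>t. t ^ m * S T t) has_real_derivative t ^ m * (1 - (S T t)\<^sup>2) powr (\<alpha> / 2)) (at t))"
    by blast
  have S: "\<And>T. T > 0 \<Longrightarrow> continuous_on UNIV (S T)" "\<And>T. T > 0 \<Longrightarrow> S T 0 = 0"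
    "\<And>T t. 0 \<le> t \<Longrightarrow> t \<le> T \<Longrightarrow> 0 < T \<Longrightarrow> 0 \<le> S T t \<and> S T t < 1"
    "\<And>T t. 0 < t \<Longrightarrow> t \<le> T \<Longrightarrow> 0 < T \<Longrightarrow>
      ((\<lambda>t. t ^ m * S T t) has_real_derivative t ^ m * (1 - (S T t)\<^sup>2) powr (\<alpha> / 2)) (at t)"
    using S0 by simp_all
  \<comment> \<open>The offset \<open>1\<close> keeps \<open>t\<close> inside the interval of
    validity, so near \<open>t\<close> the glued function coincides with the single solution
    \<open>S (t + 1)\<close>.\<close>
  define s where "s t = S (t + 1) t" for t
  have agree: "s t = S T t" if "0 \<le> t" "t < T" for t T
  proof (cases "t = 0")
    case False
    define U where "U = min T (t + 1)"
    have T: "T > 0" "t + 1 > 0" and U: "x < U \<Longrightarrow> x \<le> T" "x < U \<Longrightarrow> x \<le> t + 1" for x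
      using that by (auto simp: U_def)
    show ?thesis unfolding s_def
    proof (rule flux_equation_unique[of \<alpha> m U "S (t + 1)" "S T" t])
      show "continuous_on {0..<U} (S (t + 1))" "continuous_on {0..<U} (S T)"
        using S(1) T by (blast intro: continuous_on_subset)+
      show "0 \<le> S (t + 1) x \<and> S (t + 1) x \<le> 1" "0 \<le> S T x \<and> S T x \<le> 1"
        if "0 \<le> x" "x < U" for x
        using S(3) T U that by (auto intro: less_imp_le)
      show "((\<lambda>z. z ^ m * S (t + 1) z) has_real_derivative x ^ m * (1 - (S (t + 1) x)\<^sup>2) powr (\<alpha> / 2)) (at x)"
        if "0 < x" "x < U" for x
        using S(4)[of x "t + 1"] U(2) T that by simp
      show "((\<lambda>t. t ^ m * S T t) has_real_derivative x ^ m * (1 - (S T x)\<^sup>2) powr (\<alpha> / 2)) (at x)"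
        if "0 < x" "x < U" for x
        using S(4)[of x T] U(1) T that by simp
      show "0 < t" "t < U" using that False by (auto simp: U_def)
    qed (use assms in auto)
  qed (use that S(2) in \<open>simp add: s_def\<close>)
  have "continuous_on {0..} s"
    unfolding continuous_on_eq_continuous_within
  proof
    fix t :: real assume t: "t \<in> {0..}"
    have "isCont (S (t + 1)) t" using S(1)[of "t + 1"] t by (simp add: continuous_on_eq_continuous_at)
    then have "continuous (at t within {0..}) (S (t + 1))" by (rule continuous_at_imp_continuous_within)
    then show "continuous (at t within {0..}) s"
    proof (rule continuous_transform_within[where \<delta> = 1])
      fix x assume "x \<in> {0..}" "dist x t < 1"
      then show "S (t + 1) x = s x" using agree[of x "t + 1"] by (simp add: dist_real_def)
    qed (use t in auto)
  qed
  moreover have "((\<lambda>t. t ^ m * s t) has_real_derivative t ^ m * (1 - (s t)\<^sup>2) powr (\<alpha> / 2)) (at t)"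
    if t: "t > 0" for t
  proof -
    have "s t = S (t + 1) t" by (simp add: s_def)
    then have "((\<lambda>x. x ^ m * S (t + 1) x) has_real_derivative t ^ m * (1 - (s t)\<^sup>2) powr (\<alpha> / 2)) (at t)"
      using S(4)[of t "t + 1"] t by simp
    then show ?thesis
      by (rule has_field_derivative_transform_within_open[of _ _ _ "{0<..<t + 1}"])
        (use t agree[of _ "t + 1"] in auto)
  qed
  ultimately show ?thesis
    using S(2)[of 1] S(3) by (intro exI[of _ s]) (auto simp: s_def)
qed

lemma profile_exists:
  assumes "\<alpha> > 0" "m \<ge> 1"
  shows "\<exists>p. radial_profile \<alpha> m p"
proof -
  obtain s where s: "continuous_on {0..} s" "s 0 = 0"
    and range: "\<And>t. t \<ge> 0 \<Longrightarrow> 0 \<le> s t \<and> s t < 1"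
    and flux: "\<And>t. t > 0 \<Longrightarrow>
      ((\<lambda>t. t ^ m * s t) has_real_derivative t ^ m * (1 - (s t)\<^sup>2) powr (\<alpha> / 2)) (at t)"
    using flux_equation_exists[OF assms] by blast
  have pos: "1 - (s t)\<^sup>2 > 0" if "t \<ge> 0" for t
    using range[OF that] by (simp add: power_less_one_iff abs_square_less_1)
  define p where "p t = s t / sqrt (1 - (s t)\<^sup>2)" for t
  have "radial_profile \<alpha> m p"
  proof
    show "p 0 = 0" by (simp add: p_def s)
    show "continuous_on {0..} p"
      unfolding p_def using pos by (intro continuous_intros s) force
    fix t :: real assume t: "t > 0"
    \<comment> \<open>\<open>q\<close> is the cosine of the angle of inclination,
      \<open>1 / q^2 = 1 + p^2\<close>; hence \<open>p' = s' / q^3\<close>, which is then regrouped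
      as \<open>(1 / q^2) (s' / q)\<close>.\<close>
    define q where "q = sqrt (1 - (s t)\<^sup>2)"
    define d where "d = (1 - (s t)\<^sup>2) powr (\<alpha> / 2) - m * s t / t"
    have q: "q > 0" "(s t)\<^sup>2 = 1 - q\<^sup>2" using pos[of t] t by (auto simp: q_def)
    have s': "(s has_real_derivative d) (at t)"
      unfolding d_def by (rule DERIV_of_flux[OF assms(2) t flux[OF t]])
    have "((\<lambda>t. sqrt (1 - (s t)\<^sup>2)) has_real_derivative - (s t * d) / q) (at t)"
      using pos[of t] t q(1)
      by (auto intro!: derivative_eq_intros s' simp flip: q_def simp: field_simps)
    then have "(p has_real_derivative (d * q - s t * (- (s t * d) / q)) / (q * q)) (at t)"
      unfolding p_def using DERIV_divide[OF s', of "\<lambda>t. sqrt (1 - (s t)\<^sup>2)" "- (s t * d) / q"] q(1)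
      by (simp flip: q_def)
    also have "(d * q - s t * (- (s t * d) / q)) / (q * q) = (q\<^sup>2 + (s t)\<^sup>2) * d / q ^ 3"
      using q(1) by (simp add: field_simps power2_eq_square power3_eq_cube)
    also have "\<dots> = 1 / q\<^sup>2 * (d / q)" using q by (simp add: power2_eq_square power3_eq_cube)
    also have pq: "1 / q\<^sup>2 = 1 + (p t)\<^sup>2"
      using q by (simp add: p_def power_divide field_simps flip: q_def)
    also have "d / q = (1 + (p t)\<^sup>2) powr ((1 - \<alpha>) / 2) - m * p t / t"
    proof -
      have "1 + (p t)\<^sup>2 = 1 / q\<^sup>2" by (rule pq[symmetric])
      also have "\<dots> = q powr (-2)" using q(1) by (simp add: powr_minus_divide)
      finally have "(1 + (p t)\<^sup>2) powr ((1 - \<alpha>) / 2) = q powr (\<alpha> - 1)"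
        by (simp add: powr_powr diff_divide_distrib)
      moreover have "(1 - (s t)\<^sup>2) powr (\<alpha> / 2) = q powr \<alpha>"
        using q by (simp add: powr_powr flip: powr_numeral)
      ultimately show ?thesis using q(1) by (simp add: d_def p_def powr_diff diff_divide_distrib flip: q_def)
    qed
    finally show "(p has_real_derivative (1 + (p t)\<^sup>2) * ((1 + (p t)\<^sup>2) powr ((1 - \<alpha>) / 2) - m * p t / t)) (at t)" .
  qed (use assms in auto)
  then show ?thesis by blast
qed

section \<open>Radial functions\<close>

lemma plus_scaled_axis_nth: "(x + h *\<^sub>R axis j (1::real)) $ i = x $ i + (if i = j then h else 0)"
  by (simp add: axis_def)

lemma has_real_derivative_norm_along_axis:
  fixes x :: "real ^ 'n::finite"
  assumes "x \<noteq> 0"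
  shows "((\<lambda>h. norm (x + h *\<^sub>R axis i 1)) has_real_derivative x $ i / norm x) (at 0)"
proof -
  have "((\<lambda>h::real. x + h *\<^sub>R axis i 1) has_derivative (\<lambda>h. h *\<^sub>R axis i 1)) (at 0)"
    by (auto intro!: derivative_eq_intros)
  moreover have "(norm has_derivative (\<lambda>h. h \<bullet> sgn x)) (at (x + 0 *\<^sub>R axis i 1))"
    using has_derivative_norm[OF assms] by simp
  ultimately have "((\<lambda>h. norm (x + h *\<^sub>R axis i 1)) has_derivative (\<lambda>h. (h *\<^sub>R axis i 1) \<bullet> sgn x)) (at 0)"
    by (rule has_derivative_compose)
  moreover have "(\<lambda>h. (h *\<^sub>R axis i 1) \<bullet> sgn x) = (*) (x $ i / norm x)"
    by (simp add: sgn_div_norm inner_axis' divide_inverse mult_ac fun_eq_iff)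
  ultimately show ?thesis unfolding has_field_derivative_def by simp
qed

text \<open>First partial derivatives of \<open>r(|x|)\<close> have this form with
  \<open>f t = r' t / t\<close>, so this rule yields the second ones.\<close>

lemma radial_times_coordinate_deriv:
  fixes x :: "real ^ 'n::finite"
  assumes "x \<noteq> 0" and f: "(f has_real_derivative d) (at (norm x))"
  shows "((\<lambda>h. f (norm (x + h *\<^sub>R axis j 1)) * (x + h *\<^sub>R axis j 1) $ i) has_real_derivative
    d * (x $ j / norm x) * x $ i + f (norm x) * (if i = j then 1 else 0)) (at 0)"
proof -
  have "((\<lambda>h. f (norm (x + h *\<^sub>R axis j 1))) has_real_derivative d * (x $ j / norm x)) (at 0)"
    using DERIV_chain2[OF _ has_real_derivative_norm_along_axis[OF assms(1)], of f d j] f by simp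
  moreover have "((\<lambda>h. (x + h *\<^sub>R axis j 1) $ i) has_real_derivative (if i = j then 1 else 0)) (at 0)"
    unfolding plus_scaled_axis_nth by (auto intro!: derivative_eq_intros)
  ultimately show ?thesis
    by (rule DERIV_cong[OF DERIV_mult]) simp
qed

lemma radial_deriv:
  fixes x :: "real ^ 'n::finite"
  assumes "x \<noteq> 0" and f: "(f has_real_derivative d) (at (norm x))"
  shows "((\<lambda>h. radial f (x + h *\<^sub>R axis j 1)) has_real_derivative d * (x $ j / norm x)) (at 0)"
  unfolding radial_def
  using DERIV_chain2[OF _ has_real_derivative_norm_along_axis[OF assms(1)], of f d j] f by simp

lemma sum_components_squared: "(\<Sum>i\<in>UNIV. (x $ i)\<^sup>2) = (norm (x :: real ^ 'n::finite))\<^sup>2"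
  unfolding power2_norm_eq_inner inner_vec_def by (simp add: power2_eq_square)

text \<open>Here \<open>\<phi> x\<close> is the gradient and \<open>\<kappa> x x\<^sup>T + \<mu> I\<close> the Hessian of a radial function.\<close>

lemma mean_curvature_sum_radial:
  fixes x :: "real ^ 'n::finite"
  shows "(\<Sum>i\<in>UNIV. \<Sum>j\<in>UNIV. ((if i = j then 1 else 0) - (\<phi> * x $ i) * (\<phi> * x $ j) / c)
      * (\<kappa> * x $ i * x $ j + \<mu> * (if i = j then 1 else 0)))
    = \<kappa> * (norm x)\<^sup>2 + real CARD('n) * \<mu> - \<phi>\<^sup>2 / c * (\<kappa> * (norm x)\<^sup>2 * (norm x)\<^sup>2 + \<mu> * (norm x)\<^sup>2)"
proof -
  have "((if i = j then 1 else 0) - (\<phi> * x $ i) * (\<phi> * x $ j) / c) * (\<kappa> * x $ i * x $ j + \<mu> * (if i = j then 1 else 0))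
     = (if i = j then \<kappa> * (x $ j)\<^sup>2 + \<mu> - \<phi>\<^sup>2 / c * \<mu> * (x $ j)\<^sup>2 else 0) - \<phi>\<^sup>2 / c * \<kappa> * ((x $ i)\<^sup>2 * (x $ j)\<^sup>2)" for i j
    by (simp add: algebra_simps power2_eq_square add_divide_distrib diff_divide_distrib)
  then have "(\<Sum>i\<in>UNIV. \<Sum>j\<in>UNIV. ((if i = j then 1 else 0) - (\<phi> * x $ i) * (\<phi> * x $ j) / c)
      * (\<kappa> * x $ i * x $ j + \<mu> * (if i = j then 1 else 0)))
    = (\<Sum>i\<in>UNIV. \<kappa> * (x $ i)\<^sup>2 + \<mu> - \<phi>\<^sup>2 / c * \<mu> * (x $ i)\<^sup>2) - \<phi>\<^sup>2 / c * \<kappa> * (\<Sum>i\<in>UNIV. \<Sum>j\<in>UNIV. (x $ i)\<^sup>2 * (x $ j)\<^sup>2)"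
    by (simp add: sum_subtractf sum_distrib_left)
  also have "(\<Sum>i\<in>UNIV. \<Sum>j\<in>UNIV. (x $ i)\<^sup>2 * (x $ j)\<^sup>2) = (norm x)\<^sup>2 * (norm x)\<^sup>2"
    by (simp add: sum_product flip: sum_components_squared)
  also have "(\<Sum>i\<in>UNIV. \<kappa> * (x $ i)\<^sup>2 + \<mu> - \<phi>\<^sup>2 / c * \<mu> * (x $ i)\<^sup>2)
     = \<kappa> * (norm x)\<^sup>2 + real CARD('n) * \<mu> - \<phi>\<^sup>2 / c * \<mu> * (norm x)\<^sup>2"
    by (simp add: sum.distrib sum_subtractf flip: sum_components_squared sum_distrib_left sum_divide_distrib)
  finally show ?thesis by (simp add: algebra_simps)
qed

lemma gradient_norm_radial:
  fixes x :: "real ^ 'n::finite"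
  assumes "\<And>i. partial_deriv i u x = \<phi> * x $ i"
  shows "(norm (gradient u x))\<^sup>2 = (\<phi> * norm x)\<^sup>2"
proof -
  have "gradient u x = \<phi> *\<^sub>R x" by (simp add: gradient_def assms vec_eq_iff)
  then show ?thesis by (simp add: power_mult_distrib)
qed

lemma inverse_sqrt_powr: "(1 / sqrt (1 + z\<^sup>2)) powr (\<alpha> - 1) = (1 + z\<^sup>2) powr ((1 - \<alpha>) / 2)"
proof -
  have z: "1 + z\<^sup>2 > 0" by (simp add: add_pos_nonneg)
  have "1 / sqrt (1 + z\<^sup>2) = (1 + z\<^sup>2) powr (- 1 / 2)"
    using z by (simp add: powr_minus_divide powr_half_sqrt)
  moreover have "- 1 / 2 * (\<alpha> - 1) = (1 - \<alpha>) / 2" by (simp add: field_simps)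
  ultimately show ?thesis by (simp only: powr_powr)
qed

lemma radial_partials:
  fixes x :: "real ^ 'n::finite"
  assumes r: "\<And>t. t > 0 \<Longrightarrow> (r has_real_derivative p t) (at t)"
    and q: "(p has_real_derivative q) (at (norm x))" and x: "x \<noteq> 0"
  shows "partial_deriv i (radial r) x = p (norm x) / norm x * x $ i"
    and "((\<lambda>h. partial_deriv i (radial r) (x + h *\<^sub>R axis j 1)) has_real_derivative
       (q - p (norm x) / norm x) / (norm x)\<^sup>2 * x $ i * x $ j + p (norm x) / norm x * (if i = j then 1 else 0)) (at 0)"
proof -
  have 1: "partial_deriv i (radial r) z = p (norm z) / norm z * z $ i" if "z \<noteq> 0" for z :: "real ^ 'n"
    unfolding partial_deriv_def
    using DERIV_imp_deriv[OF radial_deriv[OF that r[of "norm z"]]] that by simp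
  show "partial_deriv i (radial r) x = p (norm x) / norm x * x $ i" by (rule 1[OF x])
  define \<rho> where "\<rho> = norm x"
  have rho: "\<rho> > 0" using x by (simp add: \<rho>_def)
  have "((\<lambda>t. p t / t) has_real_derivative (q * \<rho> - p \<rho> * 1) / (\<rho> * \<rho>)) (at (norm x))"
    using q x unfolding \<rho>_def by (intro DERIV_divide DERIV_ident) auto
  from radial_times_coordinate_deriv[OF x this, of j i]
  have "((\<lambda>h. p (norm (x + h *\<^sub>R axis j 1)) / norm (x + h *\<^sub>R axis j 1) * (x + h *\<^sub>R axis j 1) $ i) has_real_derivative
      (q * \<rho> - p \<rho> * 1) / (\<rho> * \<rho>) * (x $ j / \<rho>) * x $ i + p \<rho> / \<rho> * (if i = j then 1 else 0)) (at 0)"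
    by (simp only: \<rho>_def)
  also have "(q * \<rho> - p \<rho> * 1) / (\<rho> * \<rho>) * (x $ j / \<rho>) * x $ i = (q - p \<rho> / \<rho>) / \<rho>\<^sup>2 * x $ i * x $ j"
    using rho by (simp add: field_simps power2_eq_square)
  finally have *: "((\<lambda>h. p (norm (x + h *\<^sub>R axis j 1)) / norm (x + h *\<^sub>R axis j 1) * (x + h *\<^sub>R axis j 1) $ i) has_real_derivative
      (q - p \<rho> / \<rho>) / \<rho>\<^sup>2 * x $ i * x $ j + p \<rho> / \<rho> * (if i = j then 1 else 0)) (at 0)" .
  \<comment> \<open>The formula for the first partials holds off the origin only, which is an open
    condition on \<open>h\<close>.\<close>
  have "open {h. x + h *\<^sub>R axis j 1 \<noteq> (0 :: real ^ 'n)}"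
    by (intro open_Collect_neq continuous_intros)
  from has_field_derivative_transform_within_open[OF * this]
  show "((\<lambda>h. partial_deriv i (radial r) (x + h *\<^sub>R axis j 1)) has_real_derivative
       (q - p (norm x) / norm x) / (norm x)\<^sup>2 * x $ i * x $ j + p (norm x) / norm x * (if i = j then 1 else 0)) (at 0)"
    using x 1 by (simp add: \<rho>_def)
qed

text \<open>The Hessian has the eigenvalue \<open>q\<close> in the radial direction, damped to
  \<open>q / c\<close> by the coefficient matrix, and \<open>p / |x|\<close> in the
  \<open>CARD('n) - 1\<close> tangential ones. The equivalence serves both to read off the profile
  equation and to verify the solution.\<close>

lemma radial_equation:
  fixes x :: "real ^ 'n::finite"
  assumes r: "\<And>t. t > 0 \<Longrightarrow> (r has_real_derivative p t) (at t)"
    and q: "(p has_real_derivative q) (at (norm x))" and x: "x \<noteq> 0" and u: "u = radial r"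
  shows "(\<Sum>i\<in>UNIV. \<Sum>j\<in>UNIV.
            ((if i = j then 1 else 0)
               - partial_deriv i u x * partial_deriv j u x / (1 + (norm (gradient u x))\<^sup>2))
            * partial_deriv j (partial_deriv i u) x)
       = (1 / sqrt (1 + (norm (gradient u x))\<^sup>2)) powr (\<alpha> - 1) \<longleftrightarrow>
     q = (1 + (p (norm x))\<^sup>2) * ((1 + (p (norm x))\<^sup>2) powr ((1 - \<alpha>) / 2) - (real CARD('n) - 1) * p (norm x) / norm x)"
proof -
  define \<rho> where "\<rho> = norm x"
  have rho: "\<rho> > 0" using x by (simp add: \<rho>_def)
  define \<phi> where "\<phi> = p \<rho> / \<rho>"
  have 1: "partial_deriv i u x = \<phi> * x $ i" for i
    using radial_partials(1)[OF r q x] by (simp add: u \<phi>_def \<rho>_def)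
  have 2: "partial_deriv j (partial_deriv i u) x = (q - \<phi>) / \<rho>\<^sup>2 * x $ i * x $ j + \<phi> * (if i = j then 1 else 0)" for i j
    unfolding u \<phi>_def \<rho>_def by (subst partial_deriv_def) (rule DERIV_imp_deriv[OF radial_partials(2)[OF r q x]])
  have g: "(norm (gradient u x))\<^sup>2 = (p \<rho>)\<^sup>2"
    unfolding gradient_norm_radial[OF 1] using rho by (simp add: \<phi>_def flip: \<rho>_def)
  define c where "c = 1 + (p \<rho>)\<^sup>2"
  have c: "c > 0" by (simp add: c_def add_pos_nonneg)
  have gc: "1 + (norm (gradient u x))\<^sup>2 = c" by (simp add: g c_def)
  have "(\<Sum>i\<in>UNIV. \<Sum>j\<in>UNIV.
            ((if i = j then 1 else 0)
               - partial_deriv i u x * partial_deriv j u x / (1 + (norm (gradient u x))\<^sup>2))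
            * partial_deriv j (partial_deriv i u) x)
     = (q - \<phi>) / \<rho>\<^sup>2 * \<rho>\<^sup>2 + real CARD('n) * \<phi> - \<phi>\<^sup>2 / c * ((q - \<phi>) / \<rho>\<^sup>2 * \<rho>\<^sup>2 * \<rho>\<^sup>2 + \<phi> * \<rho>\<^sup>2)"
    unfolding 1 2 gc mean_curvature_sum_radial \<rho>_def ..
  also have "(q - \<phi>) / \<rho>\<^sup>2 * \<rho>\<^sup>2 = q - \<phi>" using rho by simp
  also have "q - \<phi> + real CARD('n) * \<phi> - \<phi>\<^sup>2 / c * ((q - \<phi>) * \<rho>\<^sup>2 + \<phi> * \<rho>\<^sup>2) = q + (real CARD('n) - 1) * \<phi> - (\<phi> * \<rho>)\<^sup>2 * q / c"
    by (simp add: algebra_simps power_mult_distrib)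
  also have "(\<phi> * \<rho>)\<^sup>2 = c - 1" using rho by (simp add: \<phi>_def c_def)
  also have "q + (real CARD('n) - 1) * \<phi> - (c - 1) * q / c = q / c + (real CARD('n) - 1) * \<phi>"
    using c by (simp add: field_simps)
  finally have lhs: "(\<Sum>i\<in>UNIV. \<Sum>j\<in>UNIV.
            ((if i = j then 1 else 0)
               - partial_deriv i u x * partial_deriv j u x / (1 + (norm (gradient u x))\<^sup>2))
            * partial_deriv j (partial_deriv i u) x) = q / c + (real CARD('n) - 1) * \<phi>" .
  have "q / c + (real CARD('n) - 1) * \<phi> = c powr ((1 - \<alpha>) / 2) \<longleftrightarrow>
     q = c * (c powr ((1 - \<alpha>) / 2) - (real CARD('n) - 1) * \<phi>)"
    using c by (auto simp: field_simps)
  moreover have "(1 / sqrt (1 + (norm (gradient u x))\<^sup>2)) powr (\<alpha> - 1) = c powr ((1 - \<alpha>) / 2)"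
    unfolding g inverse_sqrt_powr c_def ..
  ultimately show ?thesis
    unfolding lhs by (simp add: c_def \<phi>_def flip: \<rho>_def)
qed

section \<open>Correspondence between radial entire solutions and profiles\<close>

lemma radial_solution_profile:
  fixes r :: "real \<Rightarrow> real"
  assumes sol: "entire_solution \<alpha> (radial r :: real ^ 'n::finite \<Rightarrow> real)"
    and alpha: "\<alpha> > 0" and card: "CARD('n) \<ge> 2"
  shows "\<exists>p q. radial_profile \<alpha> (CARD('n) - 1) p \<and> continuous_on UNIV q \<and>
     (\<forall>t\<ge>0. (r has_real_derivative p t) (at t within {0..})) \<and> (\<forall>t. (p has_real_derivative q t) (at t))"
proof -
  \<comment> \<open>Any coordinate axis will do. Along it \<open>u\<close> equals
    \<open>r \<bar>t\<bar>\<close>, so regularity of \<open>u\<close> becomes regularity of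
    \<open>p\<close> and \<open>q\<close> on the whole line.\<close>
  define k :: 'n where "k = undefined"
  define u :: "real ^ 'n \<Rightarrow> real" where "u = radial r"
  define p where "p t = partial_deriv k u (t *\<^sub>R axis k 1)" for t
  define q where "q t = partial_deriv k (partial_deriv k u) (t *\<^sub>R axis k 1)" for t
  have C1: "C1_function u" "C1_function (partial_deriv k u)"
    using sol by (auto simp: entire_solution_def C2_function_def u_def)
  have along: "((\<lambda>t. v (t *\<^sub>R axis k 1)) has_real_derivative partial_deriv k v (t *\<^sub>R axis k 1)) (at t)"
    if "C1_function v" for v :: "real ^ 'n \<Rightarrow> real" and t
  proof -
    have "((\<lambda>h. v (t *\<^sub>R axis k 1 + h *\<^sub>R axis k 1)) has_real_derivative partial_deriv k v (t *\<^sub>R axis k 1)) (at 0)"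
      using that unfolding C1_function_def partial_deriv_def DERIV_deriv_iff_real_differentiable by blast
    then show ?thesis
      using DERIV_shift[of "\<lambda>t. v (t *\<^sub>R axis k 1)" "partial_deriv k v (t *\<^sub>R axis k 1)" 0 t]
      by (simp add: scaleR_add_left add.commute)
  qed
  have cont: "continuous_on UNIV (\<lambda>t. partial_deriv k v (t *\<^sub>R axis k 1))"
    if "C1_function v" for v :: "real ^ 'n \<Rightarrow> real"
    using that unfolding C1_function_def
    by (intro continuous_on_compose2[of UNIV "partial_deriv k v" UNIV "\<lambda>t. t *\<^sub>R axis k 1"] continuous_intros) auto
  have U: "u (t *\<^sub>R axis k 1) = r \<bar>t\<bar>" for t by (simp add: u_def radial_def)
  have r_abs: "((\<lambda>t. r \<bar>t\<bar>) has_real_derivative p t) (at t)" for t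
    using along[OF C1(1), of t] by (simp add: U p_def)
  have p_deriv: "(p has_real_derivative q t) (at t)" for t
    using along[OF C1(2), of t] by (simp add: p_def[abs_def] q_def)
  have r_deriv: "(r has_real_derivative p t) (at t within {0..})" if "t \<ge> 0" for t
    by (rule has_field_derivative_transform_within[OF has_field_derivative_at_within[OF r_abs], of 1])
      (use that in auto)
  have r_pos: "(r has_real_derivative p t) (at t)" if "t > 0" for t
  proof -
    have "at t within {0..} = at t" using that by (intro at_within_interior) auto
    then show ?thesis using r_deriv[of t] that by simp
  qed
  \<comment> \<open>The even function \<open>r \<bar>t\<bar>\<close> equals its reflection, which
    forces its derivative at \<open>0\<close> to vanish.\<close>
  have "((\<lambda>t. r \<bar>t\<bar>) has_real_derivative - p 0) (at 0)"
    using DERIV_mirror[of "\<lambda>t. r \<bar>t\<bar>" "p 0" 0] r_abs[of 0] by simp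
  then have "p 0 = - p 0" by (rule DERIV_unique[OF r_abs])
  then have "p 0 = 0" by linarith
  have "radial_profile \<alpha> (CARD('n) - 1) p"
  proof
    show "continuous_on {0..} p"
      using cont[OF C1(1)] by (auto simp: p_def[abs_def] intro: continuous_on_subset)
    fix t :: real assume t: "t > 0"
    define x :: "real ^ 'n" where "x = t *\<^sub>R axis k 1"
    have x: "x \<noteq> 0" "norm x = t" using t by (auto simp: x_def axis_eq_0_iff)
    have "q t = (1 + (p (norm x))\<^sup>2) * ((1 + (p (norm x))\<^sup>2) powr ((1 - \<alpha>) / 2) - (real CARD('n) - 1) * p (norm x) / norm x)"
      using radial_equation[OF r_pos, of "q t" x u \<alpha>] p_deriv[of t] sol x
      by (auto simp: entire_solution_def u_def)
    then show "(p has_real_derivative (1 + (p t)\<^sup>2) * ((1 + (p t)\<^sup>2) powr ((1 - \<alpha>) / 2) - real (CARD('n) - 1) * p t / t)) (at t)"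
      using p_deriv[of t] card by (simp add: x of_nat_diff)
  qed (use alpha card \<open>p 0 = 0\<close> in auto)
  moreover have "continuous_on UNIV q" using cont[OF C1(2)] by (simp add: q_def[abs_def])
  ultimately show ?thesis using r_deriv p_deriv by blast
qed

lemma profile_radial_solution:
  assumes prof: "radial_profile \<alpha> (CARD('n) - 1) p" and card: "CARD('n::finite) \<ge> 2"
  shows "\<exists>r. entire_solution \<alpha> (radial r :: real ^ 'n \<Rightarrow> real)"
proof -
  define m where "m = CARD('n) - 1"
  interpret radial_profile \<alpha> m p unfolding m_def by (rule prof)
  have n: "real CARD('n) = real m + 1" using card by (simp add: m_def of_nat_diff)
  define r where "r t = integral {0..t} p" for t
  define u :: "real ^ 'n \<Rightarrow> real" where "u = radial r"
  \<comment> \<open>The value of \<open>q\<close> at \<open>0\<close>, and likewise that of \<phi>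
    below, is the limit from \<open>slope_limit\<close> and \<open>p_over_t_limit\<close>; the main
    work of this proof is C2 regularity at the origin.\<close>
  define q where "q t = (if t = 0 then 1 / (real m + 1) else
     (1 + (p t)\<^sup>2) * ((1 + (p t)\<^sup>2) powr ((1 - \<alpha>) / 2) - m * p t / t))" for t
  define \<phi> where "\<phi> t = (if t = 0 then 1 / (real m + 1) else p t / t)" for t
  have r_Icc: "(r has_real_derivative p t) (at t within {0..t + 1})" if "t \<ge> 0" for t
    unfolding r_def
    using integral_has_real_derivative[OF continuous_on_subset[OF cont], of 0 "t + 1" t] that by auto
  have r_deriv: "(r has_real_derivative p t) (at t)" if "t > 0" for t
  proof -
    have "at t within {0..t + 1} = at t" using that by (intro at_within_interior) auto
    then show ?thesis using r_Icc[of t] that by simp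
  qed
  have r_abs: "((\<lambda>h. r \<bar>h\<bar>) has_real_derivative 0) (at 0)"
  proof -
    have "((\<lambda>y. (r y - r 0) / (y - 0)) \<longlongrightarrow> 0) (at 0 within {0..1})"
      using r_Icc[of 0] by (simp add: has_field_derivative_iff zero)
    moreover have "filterlim abs (at 0 within {0..1}) (at (0::real))"
      unfolding filterlim_at
    proof
      show "eventually (\<lambda>x::real. \<bar>x\<bar> \<in> {0..1} \<and> \<bar>x\<bar> \<noteq> 0) (at 0)"
        unfolding eventually_at by (intro exI[of _ 1]) (auto simp: dist_real_def)
      show "(abs \<longlongrightarrow> 0) (at (0::real))" by (auto intro!: tendsto_eq_intros)
    qed
    ultimately have "((\<lambda>h. (r \<bar>h\<bar> - r 0) / (\<bar>h\<bar> - 0)) \<longlongrightarrow> 0) (at 0)"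
      by (rule filterlim_compose)
    \<comment> \<open>The quotients with denominators \<open>h\<close> and
      \<open>\<bar>h\<bar>\<close> differ at most in sign, so their absolute values share the limit
      \<open>0\<close>.\<close>
    then have "((\<lambda>h. (r \<bar>h\<bar> - r \<bar>0\<bar>) / (h - 0)) \<longlongrightarrow> 0) (at 0)"
      by (rule tendsto_norm_zero_cancel[OF Lim_transform_eventually[OF tendsto_norm_zero]]) simp
    then show ?thesis by (simp add: has_field_derivative_iff)
  qed
  have q_deriv: "(p has_real_derivative q t) (at t)" if "t > 0" for t
    using ode[OF that] that by (simp add: q_def)
  have cont_ext: "continuous_on {0..} (\<lambda>t. if t = 0 then c else f t)"
    if "continuous_on {0<..} f" "(f \<longlongrightarrow> c) (at_right 0)" for f :: "real \<Rightarrow> real" and c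
    unfolding continuous_on_eq_continuous_within
  proof
    fix t :: real assume "t \<in> {0..}"
    then consider "t = 0" | "t > 0" by force
    then show "continuous (at t within {0..}) (\<lambda>t. if t = 0 then c else f t)"
    proof cases
      case 1
      have "at 0 within {0..} = at_right (0::real)"
        by (rule at_within_Ici_at_right)
      moreover have "((\<lambda>t. if t = 0 then c else f t) \<longlongrightarrow> c) (at_right 0)"
        by (rule Lim_transform_eventually[OF that(2)])
          (use eventually_at_right_less[of "0::real"] in eventually_elim, simp)
      ultimately show ?thesis using 1 by (simp add: continuous_within)
    next
      case 2
      then have "isCont f t" using that(1) by (simp add: continuous_on_eq_continuous_at)
      then have "isCont (\<lambda>t. if t = 0 then c else f t) t"
      proof (rule continuous_transform_within[where \<delta> = t])
        show "\<And>x. x \<in> UNIV \<Longrightarrow> dist x t < t \<Longrightarrow> f x = (if x = 0 then c else f x)"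
          by (auto simp: dist_real_def)
      qed (use 2 in auto)
      then show ?thesis by (rule continuous_at_imp_continuous_within)
    qed
  qed
  have p_cont: "continuous_on {0<..} p" by (rule continuous_on_subset[OF cont]) auto
  have q_cont: "continuous_on {0..} q"
    unfolding q_def by (intro cont_ext slope_limit continuous_intros p_cont) auto
  have phi_cont: "continuous_on {0..} \<phi>"
    unfolding \<phi>_def by (intro cont_ext p_over_t_limit continuous_intros p_cont) auto
  have first: "((\<lambda>h. u (x + h *\<^sub>R axis i 1)) has_real_derivative \<phi> (norm x) * x $ i) (at 0)" for x i
  proof (cases "x = 0")
    case True
    then show ?thesis using r_abs by (simp add: u_def radial_def)
  next
    case False
    then show ?thesis using radial_deriv[OF False r_deriv[of "norm x"], of i] by (simp add: u_def \<phi>_def)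
  qed
  then have p1: "partial_deriv i u = (\<lambda>x. \<phi> (norm x) * x $ i)" for i
    by (simp add: partial_deriv_def fun_eq_iff DERIV_imp_deriv)
  \<comment> \<open>At \<open>t = 0\<close> division by zero gives the value \<open>0\<close>, which
    is harmless: \<kappa> occurs only multiplied by \<open>x $ i * x $ j\<close>.\<close>
  define \<kappa> where "\<kappa> t = (q t - \<phi> t) / t\<^sup>2" for t
  have second: "((\<lambda>h. partial_deriv i u (x + h *\<^sub>R axis j 1)) has_real_derivative
      \<kappa> (norm x) * x $ i * x $ j + \<phi> (norm x) * (if i = j then 1 else 0)) (at 0)" for x i j
  proof (cases "x = 0")
    case True
    have "((\<lambda>h. \<phi> \<bar>h\<bar> * (if i = j then h else 0)) has_real_derivative \<phi> 0 * (if i = j then 1 else 0)) (at 0)"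
    proof (cases "i = j")
      case True
      have "((\<lambda>h. \<phi> \<bar>h\<bar>) \<longlongrightarrow> \<phi> \<bar>0\<bar>) (at 0)"
      proof (rule isContD)
        have "continuous_on UNIV (\<lambda>h. \<phi> \<bar>h\<bar>)"
          by (rule continuous_on_compose2[OF phi_cont]) (auto intro: continuous_intros)
        then show "isCont (\<lambda>h. \<phi> \<bar>h\<bar>) 0" by (simp add: continuous_on_eq_continuous_at)
      qed
      then have "((\<lambda>h. (\<phi> \<bar>h\<bar> * h - \<phi> \<bar>0\<bar> * 0) / (h - 0)) \<longlongrightarrow> \<phi> 0) (at 0)"
        unfolding abs_zero by (rule Lim_transform_eventually) (auto simp: eventually_at_filter)
      then show ?thesis using True by (simp add: has_field_derivative_iff)
    qed simp
    moreover have "(\<lambda>h. partial_deriv i u (0 + h *\<^sub>R axis j 1)) = (\<lambda>h. \<phi> \<bar>h\<bar> * (if i = j then h else 0))"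
      unfolding p1 plus_scaled_axis_nth by (rule ext) simp
    ultimately show ?thesis unfolding True by (simp only: zero_index mult_zero_left mult_zero_right add_0 norm_zero)
  next
    case False
    then show ?thesis
      using radial_partials(2)[OF r_deriv q_deriv[of "norm x"] False, of i j] by (simp add: u_def \<kappa>_def \<phi>_def)
  qed
  then have p2: "partial_deriv j (partial_deriv i u) = (\<lambda>x. \<kappa> (norm x) * x $ i * x $ j + \<phi> (norm x) * (if i = j then 1 else 0))" for i j
    unfolding partial_deriv_def[of j] by (intro ext DERIV_imp_deriv)
  have phi_norm: "continuous_on UNIV (\<lambda>x::real ^ 'n. \<phi> (norm x))"
    by (rule continuous_on_compose2[OF phi_cont]) (auto intro: continuous_intros)
  have "continuous_on UNIV (\<lambda>x::real ^ 'n. \<kappa> (norm x) * x $ i * x $ j)" for i j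
    unfolding continuous_on_eq_continuous_at[OF open_UNIV]
  proof
    fix x :: "real ^ 'n"
    have diff: "continuous_on UNIV (\<lambda>x::real ^ 'n. q (norm x) - \<phi> (norm x))"
      by (intro continuous_intros phi_norm continuous_on_compose2[OF q_cont]) auto
    show "isCont (\<lambda>x. \<kappa> (norm x) * x $ i * x $ j) x"
    proof (cases "x = 0")
      case True
      have "((\<lambda>x::real ^ 'n. q (norm x) - \<phi> (norm x)) \<longlongrightarrow> q (norm (0 :: real ^ 'n)) - \<phi> (norm (0 :: real ^ 'n))) (at 0)"
        using diff unfolding continuous_on_def by blast
      then have lim: "((\<lambda>x::real ^ 'n. q (norm x) - \<phi> (norm x)) \<longlongrightarrow> 0) (at 0)"
        by (simp add: q_def \<phi>_def)
      \<comment> \<open>\<kappa> itself need not be bounded, but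
        \<open>\<bar>z $ i * z $ j\<bar> \<le> (norm z)^2\<close> cancels its denominator, and
        \<open>q - \<phi>\<close> tends to \<open>0\<close> at the origin.\<close>
      have "\<bar>\<kappa> (norm z) * z $ i * z $ j\<bar> \<le> \<bar>q (norm z) - \<phi> (norm z)\<bar>" for z :: "real ^ 'n"
      proof -
        have "\<bar>z $ i\<bar> * \<bar>z $ j\<bar> \<le> norm z * norm z"
          by (intro mult_mono component_le_norm_cart) auto
        then have "\<bar>q (norm z) - \<phi> (norm z)\<bar> * (\<bar>z $ i\<bar> * \<bar>z $ j\<bar>) \<le> \<bar>q (norm z) - \<phi> (norm z)\<bar> * (norm z)\<^sup>2"
          by (intro mult_left_mono) (auto simp: power2_eq_square)
        moreover have "\<bar>\<kappa> (norm z) * z $ i * z $ j\<bar> = \<bar>q (norm z) - \<phi> (norm z)\<bar> * (\<bar>z $ i\<bar> * \<bar>z $ j\<bar>) / (norm z)\<^sup>2"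
          by (simp add: \<kappa>_def abs_mult)
        ultimately show ?thesis
          by (cases "z = 0") (auto simp: pos_divide_le_eq)
      qed
      then have "((\<lambda>x::real ^ 'n. \<kappa> (norm x) * x $ i * x $ j) \<longlongrightarrow> 0) (at 0)"
        by (intro Lim_null_comparison[OF _ tendsto_rabs_zero[OF lim]]) (auto intro!: always_eventually)
      then show ?thesis using True by (simp add: isCont_def)
    next
      case False
      have "continuous_on (- {0}) (\<lambda>x::real ^ 'n. \<kappa> (norm x) * x $ i * x $ j)"
        unfolding \<kappa>_def by (intro continuous_intros continuous_on_subset[OF diff]) auto
      moreover have "open (- {0 :: real ^ 'n})" by (rule open_Compl) simp
      ultimately show ?thesis using False continuous_on_eq_continuous_at by blast
    qed
  qed
  then have p2_cont: "continuous_on UNIV (partial_deriv j (partial_deriv i u))" for i j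
    unfolding p2 by (intro continuous_on_add continuous_on_mult_right phi_norm)
  have "C1_function u" unfolding C1_function_def
  proof (intro allI conjI)
    show "(\<lambda>h. u (x + h *\<^sub>R axis i 1)) differentiable at 0" for x i
      using first real_differentiable_def by blast
    show "continuous_on UNIV (partial_deriv i u)" for i
      unfolding p1 by (intro continuous_intros phi_norm)
  qed
  moreover have "C1_function (partial_deriv i u)" for i
    unfolding C1_function_def
    using second p2_cont real_differentiable_def by blast
  moreover have "(\<Sum>i\<in>UNIV. \<Sum>j\<in>UNIV.
            ((if i = j then 1 else 0)
               - partial_deriv i u x * partial_deriv j u x / (1 + (norm (gradient u x))\<^sup>2))
            * partial_deriv j (partial_deriv i u) x)
       = (1 / sqrt (1 + (norm (gradient u x))\<^sup>2)) powr (\<alpha> - 1)" for x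
  proof (cases "x = 0")
    case True
    have g: "(norm (gradient u x))\<^sup>2 = (\<phi> (norm x) * norm x)\<^sup>2"
      by (rule gradient_norm_radial) (simp add: p1)
    \<comment> \<open>At the origin the gradient vanishes and the Hessian is \<open>\<phi> 0\<close>
      times the identity, so the equation reduces to its trace being \<open>1\<close>.\<close>
    have "real CARD('n) * \<phi> 0 = 1" by (simp add: \<phi>_def n)
    then show ?thesis
      unfolding g unfolding p1 p2[unfolded p1] mean_curvature_sum_radial using True by simp
  next
    case False
    then show ?thesis
      by (subst radial_equation[OF r_deriv q_deriv False u_def]) (auto simp: q_def n)
  qed
  ultimately have "entire_solution \<alpha> u"
    unfolding entire_solution_def C2_function_def by blast
  then show ?thesis unfolding u_def by blast
qed

section \<open>Entire radial solutions\<close>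

context radial_profile
begin

text \<open>Integration of \<open>slope_asymptotics_1\<close>; the term
  \<open>m (m - 3) t^(-3)\<close> of the slope becomes \<open>- m (m - 3) / 2 * t^(-2)\<close>, and
  \<open>m - 3\<close> is \<open>n - 4\<close>.\<close>

lemma height_asymptotics_1:
  assumes "\<alpha> = 1" and r: "\<And>t. t > 0 \<Longrightarrow> (r has_real_derivative p t) (at t)"
  shows "\<exists>L. (\<lambda>t. r t - (t\<^sup>2 / (2 * m) - ln t + L - m * (real m - 3) / 2 * t powr (-2)))
    \<in> o[at_top](\<lambda>t. t powr (-2))"
proof -
  define f where "f t = r t - (t\<^sup>2 / (2 * m) - ln t - m * (real m - 3) / 2 * t powr (-2))" for t
  define f' where "f' t = p t - t / m + 1 / t - m * (real m - 3) * t powr (-3)" for t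
  have "\<exists>L. (\<lambda>t. f t - L) \<in> o[at_top](\<lambda>t. t powr (- 2))"
  proof (rule integrate_small_o_decaying[where f' = f'])
    show "(f has_real_derivative f' t) (at t)" if "t > 0" for t
      unfolding f_def f'_def using that m
      by (auto intro!: derivative_eq_intros r simp: field_simps)
    have "((\<lambda>t. (p t - t / m + 1 / t) * t ^ 3 - m * (real m - 3)) \<longlongrightarrow> real m * (real m - 3) - m * (real m - 3)) at_top"
      by (intro tendsto_diff slope_asymptotics_1 assms tendsto_const)
    then have "((\<lambda>t. (p t - t / m + 1 / t) * t ^ 3 - m * (real m - 3)) \<longlongrightarrow> 0) at_top" by simp
    then show "((\<lambda>t. f' t * t powr (2 + 1)) \<longlongrightarrow> 0) at_top"
    proof (rule Lim_transform_eventually)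
      show "eventually (\<lambda>t. (p t - t / m + 1 / t) * t ^ 3 - m * (real m - 3) = f' t * t powr (2 + 1)) at_top"
        using eventually_gt_at_top[of 0]
      proof eventually_elim
        case (elim t)
        have "t powr (2 + 1) = t ^ 3" using elim by simp
        moreover have "t powr (-3) * t ^ 3 = 1" using elim by (simp add: powr_minus)
        ultimately show ?case unfolding f'_def by (simp add: left_diff_distrib mult.assoc)
      qed
    qed
  qed simp
  then show ?thesis by (simp add: f_def algebra_simps)
qed

text \<open>Integration of \<open>slope_asymptotics\<close>: \<open>C\<close> is the second
  coefficient \<open>B\<close> of the slope divided by \<open>1 - 1 / \<alpha>\<close>. The sign of
  this exponent decides whether the constant of integration is absorbed by the error (\<alpha> > 1)
  or has to be subtracted (\<alpha> < 1).\<close>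

lemma height_asymptotics:
  assumes "\<alpha> \<noteq> 1" and r: "\<And>t. t > 0 \<Longrightarrow> (r has_real_derivative p t) (at t)"
  defines "C \<equiv> 1 / (\<alpha> - 1) * m powr (1 / \<alpha>) * (1 / (\<alpha> * m) + (\<alpha> - 1) / 2)"
  shows "\<exists>c. (\<alpha> > 1 \<longrightarrow> c = 0) \<and>
    (\<lambda>t. r t + c - (\<alpha> / (\<alpha> + 1) * (1 / m) powr (1 / \<alpha>) * t powr (1 + 1 / \<alpha>) - C * t powr (1 - 1 / \<alpha>)))
      \<in> o[at_top](\<lambda>t. t powr (1 - 1 / \<alpha>))"
proof -
  define B where "B = m powr (1 / \<alpha>) / \<alpha> * (1 / (\<alpha> * m) + (\<alpha> - 1) / 2)"
  have CB: "C * (1 - 1 / \<alpha>) = B"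
    using alpha assms(1) by (simp add: C_def B_def field_simps)
  define f where "f t = r t - (\<alpha> / (\<alpha> + 1) * A * t powr (1 + 1 / \<alpha>) - C * t powr (1 - 1 / \<alpha>))" for t
  define f' where "f' t = p t - A * t powr (1 / \<alpha>) + B * t powr (- (1 / \<alpha>))" for t
  have f: "(f has_real_derivative f' t) (at t)" if "t > 0" for t
  proof -
    have "(f has_real_derivative p t - (\<alpha> / (\<alpha> + 1) * A * ((1 + 1 / \<alpha>) * t powr (1 + 1 / \<alpha> - 1))
        - C * ((1 - 1 / \<alpha>) * t powr (1 - 1 / \<alpha> - 1)))) (at t)"
      unfolding f_def by (intro DERIV_diff DERIV_cmult r has_real_derivative_powr that)
    also have "\<alpha> / (\<alpha> + 1) * A * ((1 + 1 / \<alpha>) * t powr (1 + 1 / \<alpha> - 1)) = (\<alpha> / (\<alpha> + 1) * (1 + 1 / \<alpha>)) * (A * t powr (1 / \<alpha>))"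
      by simp
    also have "\<alpha> / (\<alpha> + 1) * (1 + 1 / \<alpha>) = 1" using alpha by (simp add: divide_simps)
    also have "C * ((1 - 1 / \<alpha>) * t powr (1 - 1 / \<alpha> - 1)) = B * t powr (- (1 / \<alpha>))"
      by (simp flip: CB)
    finally show ?thesis by (simp add: f'_def algebra_simps)
  qed
  have "((\<lambda>t. (p t - A * t powr (1 / \<alpha>)) * t powr (1 / \<alpha>) + B) \<longlongrightarrow> - B + B) at_top"
    unfolding B_def by (intro tendsto_add slope_asymptotics tendsto_const)
  then have "((\<lambda>t. (p t - A * t powr (1 / \<alpha>)) * t powr (1 / \<alpha>) + B) \<longlongrightarrow> 0) at_top" by simp
  then have lim: "((\<lambda>t. f' t * t powr (1 / \<alpha>)) \<longlongrightarrow> 0) at_top"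
  proof (rule Lim_transform_eventually)
    show "eventually (\<lambda>t. (p t - A * t powr (1 / \<alpha>)) * t powr (1 / \<alpha>) + B = f' t * t powr (1 / \<alpha>)) at_top"
      using eventually_gt_at_top[of 0]
    proof eventually_elim
      case (elim t)
      have "t powr (- (1 / \<alpha>)) * t powr (1 / \<alpha>) = 1" using elim by (simp flip: powr_add)
      then show ?case unfolding f'_def by (simp add: distrib_right mult.assoc)
    qed
  qed
  have "\<exists>c. (\<alpha> > 1 \<longrightarrow> c = 0) \<and> (\<lambda>t. f t + c) \<in> o[at_top](\<lambda>t. t powr (1 - 1 / \<alpha>))"
  proof (cases "\<alpha> > 1")
    case True
    have "f \<in> o[at_top](\<lambda>t. t powr (1 - 1 / \<alpha>))"
      by (rule integrate_small_o_growing[OF _ f]) (use True lim in simp_all)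
    then show ?thesis by (intro exI[of _ 0]) simp
  next
    case False
    have "\<exists>L. (\<lambda>t. f t - L) \<in> o[at_top](\<lambda>t. t powr (- (1 / \<alpha> - 1)))"
      by (rule integrate_small_o_decaying[OF _ f]) (use False assms(1) alpha lim in simp_all)
    then obtain L where "(\<lambda>t. f t - L) \<in> o[at_top](\<lambda>t. t powr (1 - 1 / \<alpha>))" by auto
    then show ?thesis using False by (intro exI[of _ "- L"]) simp
  qed
  then show ?thesis by (simp add: f_def A_def algebra_simps)
qed

lemma slope_pos: "t > 0 \<Longrightarrow> deriv p t > 0"
  using DERIV_imp_deriv[OF ode'] D_pos[of t] by simp

end

section \<open>Uniqueness up to a vertical shift and conclusion\<close>

lemma profile_radial_unique:
  assumes "radial_profile \<alpha> m p" "radial_profile \<alpha> m q" "t \<ge> 0"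
    and r: "\<And>t. t \<ge> 0 \<Longrightarrow> (r has_real_derivative p t) (at t within {0..})"
    and s: "\<And>t. t \<ge> 0 \<Longrightarrow> (s has_real_derivative q t) (at t within {0..})"
  shows "s t - r t = s 0 - r 0"
proof -
  have "((\<lambda>t. s t - r t) has_real_derivative 0) (at x within {0..})" if "x \<in> {0..}" for x
    using DERIV_diff[OF s[of x] r[of x]] profile_unique[OF assms(1,2), of x] that by simp
  then obtain c where "\<And>x. x \<in> {0..} \<Longrightarrow> s x - r x = c"
    using has_field_derivative_zero_constant[of "{0..}" "\<lambda>t. s t - r t"] by blast
  then show ?thesis using \<open>t \<ge> 0\<close> by simp
qed

theorem theorem1p1:
  fixes n :: nat and \<alpha> :: real
  assumes "n = CARD('n::finite)" and "n \<ge> 2" and "\<alpha> > 0"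
  shows "(\<exists>r. entire_solution \<alpha> (radial r :: real ^ 'n \<Rightarrow> real))
    \<and> (\<forall>r s. entire_solution \<alpha> (radial r :: real ^ 'n \<Rightarrow> real)
             \<and> entire_solution \<alpha> (radial s :: real ^ 'n \<Rightarrow> real) \<longrightarrow>
          equal_up_to_translation (radial r :: real ^ 'n \<Rightarrow> real) (radial s))
    \<and> (\<forall>r. entire_solution \<alpha> (radial r :: real ^ 'n \<Rightarrow> real) \<longrightarrow>
          C2_on_halfline r
        \<and> (\<forall>t>0. deriv (deriv r) t > 0
             \<and> t / real n < deriv r t * (1 + (deriv r t)\<^sup>2) powr ((\<alpha> - 1) / 2)
             \<and> deriv r t * (1 + (deriv r t)\<^sup>2) powr ((\<alpha> - 1) / 2) < t / (real n - 1)))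
    \<and> (\<alpha> = 1 \<longrightarrow> (\<exists>C1 :: real \<Rightarrow> real. \<forall>r. entire_solution \<alpha> (radial r :: real ^ 'n \<Rightarrow> real) \<longrightarrow>
          (\<lambda>t. r t - (t\<^sup>2 / (2 * (real n - 1)) - ln t + C1 (r 1)
                        - (real n - 1) * (real n - 4) / 2 * t powr (-2)))
            \<in> o[at_top](\<lambda>t. t powr (-2))))
    \<and> (\<alpha> \<noteq> 1 \<longrightarrow> (\<forall>r. entire_solution \<alpha> (radial r :: real ^ 'n \<Rightarrow> real) \<longrightarrow> (\<exists>c. (\<alpha> > 1 \<longrightarrow> c = 0) \<and>
          (\<lambda>t. (r t + c) - (\<alpha> / (\<alpha> + 1) * (1 / (real n - 1)) powr (1 / \<alpha>) * t powr (1 + 1 / \<alpha>)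
                        - C_coeff \<alpha> n * t powr (1 - 1 / \<alpha>)))
            \<in> o[at_top](\<lambda>t. t powr (1 - 1 / \<alpha>)))))"
proof -
  define m where "m = n - 1"
  have m': "m \<ge> 1" "real n = real m + 1" "m = CARD('n) - 1" and card: "CARD('n) \<ge> 2"
    using assms by (auto simp: m_def)
  define sol where "sol r \<longleftrightarrow> entire_solution \<alpha> (radial r :: real ^ 'n \<Rightarrow> real)" for r
  have prof: "\<exists>p q. radial_profile \<alpha> m p \<and> continuous_on UNIV q \<and>
     (\<forall>t\<ge>0. (r has_real_derivative p t) (at t within {0..})) \<and> (\<forall>t. (p has_real_derivative q t) (at t))"
    if "sol r" for r
    using radial_solution_profile[of \<alpha> r] that assms(3) card unfolding sol_def m' by blast
  have interior: "(r has_real_derivative p t) (at t)"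
    if "\<forall>t\<ge>0. (r has_real_derivative p t) (at t within {0..})" "t > 0" for r p and t :: real
  proof -
    have "at t within {0..} = at t" using that by (intro at_within_interior) auto
    then show ?thesis using that by (metis less_imp_le)
  qed
  have ex: "\<exists>r. sol r"
    using profile_exists[OF \<open>\<alpha> > 0\<close> m'(1)] profile_radial_solution card unfolding sol_def m' by blast
  have shift: "s t - r t = s 0 - r 0" if "sol r" "sol s" "t \<ge> 0" for r s and t :: real
    using prof[OF that(1)] prof[OF that(2)] profile_radial_unique that(3) by blast
  have uniq: "\<forall>r s. sol r \<and> sol s \<longrightarrow> equal_up_to_translation (radial r :: real ^ 'n \<Rightarrow> real) (radial s)"
  proof (intro allI impI, elim conjE)
    fix r s assume rs: "sol r" "sol s"
    have "radial s x = radial r x + (s 0 - r 0)" for x :: "real ^ 'n"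
      using shift[OF rs, of "norm x"] by (simp add: radial_def)
    then have "fun_graph (radial s :: real ^ 'n \<Rightarrow> real) = (\<lambda>p. p + (0, s 0 - r 0)) ` fun_graph (radial r)"
      by (auto simp: fun_graph_def image_image)
    then show "equal_up_to_translation (radial r :: real ^ 'n \<Rightarrow> real) (radial s)"
      unfolding equal_up_to_translation_def by blast
  qed
  have regular: "\<forall>r. sol r \<longrightarrow> C2_on_halfline r
        \<and> (\<forall>t>0. deriv (deriv r) t > 0
             \<and> t / real n < deriv r t * (1 + (deriv r t)\<^sup>2) powr ((\<alpha> - 1) / 2)
             \<and> deriv r t * (1 + (deriv r t)\<^sup>2) powr ((\<alpha> - 1) / 2) < t / (real n - 1))"
  proof (intro allI impI)
    fix r assume r: "sol r"
    obtain p q where pq: "radial_profile \<alpha> m p" "continuous_on UNIV q"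
      "\<forall>t\<ge>0. (r has_real_derivative p t) (at t within {0..})" "\<forall>t. (p has_real_derivative q t) (at t)"
      using prof[OF r] by blast
    interpret radial_profile \<alpha> m p by fact
    have "C2_on_halfline r"
      unfolding C2_on_halfline_def
      using pq by (blast intro: has_field_derivative_at_within continuous_on_subset)
    moreover have r': "deriv r t = p t" if "t > 0" for t
      using interior[OF pq(3) that] by (rule DERIV_imp_deriv)
    moreover have "deriv (deriv r) t = deriv p t" if "t > 0" for t
    proof (rule deriv_cong_ev)
      have "eventually (\<lambda>x. x \<in> {0<..}) (nhds t)" using that by (intro eventually_nhds_in_open) auto
      then show "eventually (\<lambda>x. deriv r x = p x) (nhds t)"
        by eventually_elim (simp add: r')
    qed simp
    ultimately show "C2_on_halfline r
        \<and> (\<forall>t>0. deriv (deriv r) t > 0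
             \<and> t / real n < deriv r t * (1 + (deriv r t)\<^sup>2) powr ((\<alpha> - 1) / 2)
             \<and> deriv r t * (1 + (deriv r t)\<^sup>2) powr ((\<alpha> - 1) / 2) < t / (real n - 1))"
      using slope_pos y_lower y_upper by (simp add: y_def m'(2) add.commute)
  qed
  have one: "\<alpha> = 1 \<longrightarrow> (\<exists>C1 :: real \<Rightarrow> real. \<forall>r. sol r \<longrightarrow>
          (\<lambda>t. r t - (t\<^sup>2 / (2 * (real n - 1)) - ln t + C1 (r 1)
                        - (real n - 1) * (real n - 4) / 2 * t powr (-2)))
            \<in> o[at_top](\<lambda>t. t powr (-2)))"
  proof
    assume alpha1: "\<alpha> = 1"
    obtain r0 where r0: "sol r0" using ex by blast
    obtain p where p: "radial_profile \<alpha> m p" "\<forall>t\<ge>0. (r0 has_real_derivative p t) (at t within {0..})"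
      using prof[OF r0] by blast
    obtain L where L: "(\<lambda>t. r0 t - (t\<^sup>2 / (2 * m) - ln t + L - m * (real m - 3) / 2 * t powr (-2)))
        \<in> o[at_top](\<lambda>t. t powr (-2))"
      using radial_profile.height_asymptotics_1[OF p(1) alpha1 interior[OF p(2)]] by blast
    have n: "real n - 1 = m" "real n - 4 = real m - 3" using m' by simp_all
    show "\<exists>C1 :: real \<Rightarrow> real. \<forall>r. sol r \<longrightarrow>
          (\<lambda>t. r t - (t\<^sup>2 / (2 * (real n - 1)) - ln t + C1 (r 1)
                        - (real n - 1) * (real n - 4) / 2 * t powr (-2)))
            \<in> o[at_top](\<lambda>t. t powr (-2))"
    \<comment> \<open>Every solution is \<open>r0\<close> plus the constant
      \<open>r 1 - r0 1\<close>, so its constant term is that of \<open>r0\<close>, namely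
      \<open>L\<close>, shifted by this amount.\<close>
    proof (intro exI[of _ "\<lambda>z. z - r0 1 + L"] allI impI)
      fix r assume r: "sol r"
      have "r t - r0 t = r 1 - r0 1" if "t \<ge> 0" for t
        using shift[OF r0 r that] shift[OF r0 r, of 1] by simp
      then have eq: "r0 t - (t\<^sup>2 / (2 * m) - ln t + L - m * (real m - 3) / 2 * t powr (-2)) =
         r t - (t\<^sup>2 / (2 * m) - ln t + (r 1 - r0 1 + L) - m * (real m - 3) / 2 * t powr (-2))" if "t \<ge> 0" for t
        by (smt (verit) that)
      then have "eventually (\<lambda>t. r0 t - (t\<^sup>2 / (2 * m) - ln t + L - m * (real m - 3) / 2 * t powr (-2)) =
         r t - (t\<^sup>2 / (2 * m) - ln t + (r 1 - r0 1 + L) - m * (real m - 3) / 2 * t powr (-2))) at_top"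
        by (rule eventually_mono[OF eventually_ge_at_top[of 0]])
      from landau_o.small.in_cong[OF this] L
      show "(\<lambda>t. r t - (t\<^sup>2 / (2 * (real n - 1)) - ln t + (r 1 - r0 1 + L)
                        - (real n - 1) * (real n - 4) / 2 * t powr (-2)))
            \<in> o[at_top](\<lambda>t. t powr (-2))" unfolding n by simp
    qed
  qed
  have other: "\<alpha> \<noteq> 1 \<longrightarrow> (\<forall>r. sol r \<longrightarrow> (\<exists>c. (\<alpha> > 1 \<longrightarrow> c = 0) \<and>
          (\<lambda>t. (r t + c) - (\<alpha> / (\<alpha> + 1) * (1 / (real n - 1)) powr (1 / \<alpha>) * t powr (1 + 1 / \<alpha>)
                        - C_coeff \<alpha> n * t powr (1 - 1 / \<alpha>)))
            \<in> o[at_top](\<lambda>t. t powr (1 - 1 / \<alpha>))))"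
  proof (intro impI allI)
    fix r assume alpha: "\<alpha> \<noteq> 1" and r: "sol r"
    obtain p where p: "radial_profile \<alpha> m p" "\<forall>t\<ge>0. (r has_real_derivative p t) (at t within {0..})"
      using prof[OF r] by blast
    have n: "real n - 1 = m" using m' by simp
    show "\<exists>c. (\<alpha> > 1 \<longrightarrow> c = 0) \<and>
          (\<lambda>t. (r t + c) - (\<alpha> / (\<alpha> + 1) * (1 / (real n - 1)) powr (1 / \<alpha>) * t powr (1 + 1 / \<alpha>)
                        - C_coeff \<alpha> n * t powr (1 - 1 / \<alpha>)))
            \<in> o[at_top](\<lambda>t. t powr (1 - 1 / \<alpha>))"
      unfolding C_coeff_def n
      by (rule radial_profile.height_asymptotics[OF p(1) alpha interior[OF p(2)]])
  qed
  show ?thesis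
    unfolding sol_def[symmetric] by (intro conjI ex uniq regular one other)
qed

end
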